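(* Let $n \ge m\ge 1$ and $t\ge 2$ be integers. Let $\Delta_{m,n}$ be the $m\times n$ chessboard complex and $\mathcal{F}(\Delta_{m,n})$ its facet ideal. Then the $\mathrm{v}$-number of the $t$-th symbolic power of $\mathcal{F}(\Delta_{m,n})$ is \[ \mathrm{v}(\mathcal{F}(\Delta_{m,n})^{(t)})= \begin{cases} t-1, & \text{if } m=1,\\ mt, & \text{if } n=m\ge 2,\\ mt-1, & \text{if } n>m\ge 2. \end{cases} \]
   Context: Let $\mathbb{K}$ be a field and $S=\mathbb{K}[x_{i,j}\mid 1\le i\le m,\ 1\le j\le n]$ the standard graded polynomial ring, $S_d$ its degree $d$ component. The variable $x_{i,j}$ is identified with the square in row $i$ and column $j$ of an $m\times n$ chessboard. Chessboard complex: $\Delta_{m,n}$ is the simplicial complex on the vertex set $V=\{x_{i,j}\mid 1\le i\le m,\ 1\le j\le n\}$ whose faces are the subsets of $V$ with no two squares in the same row or the same column. A facet is a face maximal with respect to inclusion. Facet ideal: for $F\subseteq V$ put $\mathbf{x}_F=\prod_{x\in F}x$. Then $\mathcal{F}(\Delta_{m,n})=(\mathbf{x}_F\mid F \text{ a facet of } \Delta_{m,n})\subseteq S$; explicitly (as $n\ge m$), $\mathcal{F}(\Delta_{m,n})=(x_{1,\ell_1}\cdots x_{m,\ell_m}\mid 1\le \ell_1,\dots,\ell_m\le n \text{ pairwise distinct})$. Symbolic power: for a graded ideal $I\subseteq S$ the $t$-th symbolic power is $I^{(t)}=\left(\bigcap_{\mathfrak{p}\in\operatorname{Min}(I)} I^tS_{\mathfrak{p}}\right)\cap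 S$, where $\operatorname{Min}(I)$ is the set of minimal primes of $I$ and $S_{\mathfrak{p}}$ is the localization of $S$ at $\mathfrak{p}$. $\mathrm{v}$-number: for a graded ideal $I\subseteq S$, let $\operatorname{Ass}(I)$ be the set of associated primes of $I$ (i.e. of $S/I$). For $\mathfrak{p}\in\operatorname{Ass}(I)$ let $\mathrm{v}_{\mathfrak{p}}(I)=\min\{d\ge 0\mid \text{there exists } f\in S_d \text{ with } (I:f)=\mathfrak{p}\}$, and let $\mathrm{v}(I)=\min\{\mathrm{v}_{\mathfrak{p}}(I)\mid \mathfrak{p}\in\operatorname{Ass}(I)\}$. *)

theory Defs
  imports
    "HOL-Library.Poly_Mapping"
    "HOL-Library.Product_Lexorder"
    "HOL-Computational_Algebra.Fraction_Field"
    "HOL-Algebra.Ideal_Product"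
    "HOL-Algebra.QuotRing"
begin

section \<open>Ideals\<close>

definition colon :: "('a, 'b) ring_scheme \<Rightarrow> 'a set \<Rightarrow> 'a \<Rightarrow> 'a set" where
  "colon R I f = {g \<in> carrier R. g \<otimes>\<^bsub>R\<^esub> f \<in> I}"

definition min_primes :: "('a, 'b) ring_scheme \<Rightarrow> 'a set \<Rightarrow> 'a set set" where
  "min_primes R I =
     {P. primeideal P R \<and> I \<subseteq> P \<and> \<not> (\<exists>Q. primeideal Q R \<and> I \<subseteq> Q \<and> Q \<subset> P)}"

text \<open>The associated primes of \<open>I\<close> are the primes that are the annihilator of some element
  of the \<open>R\<close>-module \<open>R/I\<close>; a scalar \<open>g\<close> acts on \<open>R/I\<close> as multiplication by its class.\<close>

definition assoc_primes :: "('a, 'b) ring_scheme \<Rightarrow> 'a set \<Rightarrow> 'a set set" where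
  "assoc_primes R I =
     {P. primeideal P R \<and>
         (\<exists>a \<in> carrier (R Quot I).
            P = {g \<in> carrier R. (I +>\<^bsub>R\<^esub> g) \<otimes>\<^bsub>R Quot I\<^esub> a = \<zero>\<^bsub>R Quot I\<^esub>})}"

section \<open>Localizations and symbolic powers\<close>

text \<open>The carrier \<open>A\<close> is meant to be closed under the ring operations of its type.\<close>

definition ring_on :: "'a::comm_ring_1 set \<Rightarrow> 'a ring" where
  "ring_on A = \<lparr>carrier = A, mult = (*), one = 1, zero = 0, add = (+)\<rparr>"

text \<open>For a prime \<open>P\<close> of the domain \<open>A\<close>, both \<open>A\<close> (via \<open>a \<mapsto> a/1\<close>) and all localizations \<open>A\<^sub>P\<close>
  live in one field of fractions; this is where the intersection over the minimal primes is
  formed.\<close>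

definition localization :: "'a::idom set \<Rightarrow> 'a set \<Rightarrow> 'a fract ring" where
  "localization A P = ring_on {Fract a b | a b. a \<in> A \<and> b \<in> A - P}"

definition extended_ideal :: "'a::idom set \<Rightarrow> 'a set \<Rightarrow> 'a set \<Rightarrow> 'a fract set" where
  "extended_ideal A P J = Idl\<^bsub>localization A P\<^esub> ((\<lambda>a. Fract a 1) ` J)"

definition symbolic_power :: "'a::idom set \<Rightarrow> 'a set \<Rightarrow> nat \<Rightarrow> 'a set" where
  "symbolic_power A I t =
     {f \<in> A. Fract f 1 \<in>
        (\<Inter>P \<in> min_primes (ring_on A) I. extended_ideal A P (I [^]\<^bsub>ideals_set (ring_on A)\<^esub> t))}"

section \<open>The polynomial ring of the chessboard\<close>

text \<open>Polynomials are finitely supported functions from exponents to coefficients. The type has a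
  variable for every pair of natural numbers; \<open>board_poly m n\<close> keeps those of the
  \<open>m \<times> n\<close> board. The lexicographic order on pairs is used only for the instance of class
  \<open>idom\<close>.\<close>

type_synonym 'k grid_poly = "((nat \<times> nat) \<Rightarrow>\<^sub>0 nat) \<Rightarrow>\<^sub>0 'k"

definition squares :: "nat \<Rightarrow> nat \<Rightarrow> (nat \<times> nat) set" where
  "squares m n = {1..m} \<times> {1..n}"

definition board_poly :: "nat \<Rightarrow> nat \<Rightarrow> 'k::field grid_poly set" where
  "board_poly m n = {f. \<forall>e \<in> Poly_Mapping.keys f. Poly_Mapping.keys e \<subseteq> squares m n}"

definition board_ring :: "nat \<Rightarrow> nat \<Rightarrow> 'k::field grid_poly ring" where
  "board_ring m n = ring_on (board_poly m n)"

definition var :: "nat \<times> nat \<Rightarrow> 'k::field grid_poly" where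
  "var v = Poly_Mapping.single (Poly_Mapping.single v 1) 1"

definition mon_degree :: "((nat \<times> nat) \<Rightarrow>\<^sub>0 nat) \<Rightarrow> nat" where
  "mon_degree e = (\<Sum>v \<in> Poly_Mapping.keys e. Poly_Mapping.lookup e v)"

definition graded_part :: "nat \<Rightarrow> nat \<Rightarrow> nat \<Rightarrow> 'k::field grid_poly set" where
  "graded_part m n d = {f \<in> board_poly m n. \<forall>e \<in> Poly_Mapping.keys f. mon_degree e = d}"

section \<open>The v-number\<close>

text \<open>For a graded ideal \<open>I\<close> both sets below are nonempty when \<open>P\<close> is an associated prime and \<open>I\<close>
  is proper, so that \<open>Inf\<close> on the naturals is a minimum; \<open>Inf {} = 0\<close>, so a positive v-number
  already implies that all these minima exist.\<close>

definition v_number_at :: "nat \<Rightarrow> nat \<Rightarrow> 'k::field grid_poly set \<Rightarrow> 'k grid_poly set \<Rightarrow> nat" where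
  "v_number_at m n I P = Inf {d. \<exists>f \<in> graded_part m n d. colon (board_ring m n) I f = P}"

definition v_number :: "nat \<Rightarrow> nat \<Rightarrow> 'k::field grid_poly set \<Rightarrow> nat" where
  "v_number m n I = Inf (v_number_at m n I ` assoc_primes (board_ring m n) I)"

section \<open>The chessboard complex and its facet ideal\<close>

definition chessboard_complex :: "nat \<Rightarrow> nat \<Rightarrow> (nat \<times> nat) set set" where
  "chessboard_complex m n =
     {F. F \<subseteq> squares m n \<and>
         (\<forall>a \<in> F. \<forall>b \<in> F. a \<noteq> b \<longrightarrow> fst a \<noteq> fst b \<and> snd a \<noteq> snd b)}"

definition facets :: "'v set set \<Rightarrow> 'v set set" where
  "facets \<Delta> = {F \<in> \<Delta>. \<not> (\<exists>G \<in> \<Delta>. F \<subset> G)}"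

definition facet_ideal :: "nat \<Rightarrow> nat \<Rightarrow> 'k::field grid_poly set" where
  "facet_ideal m n =
     Idl\<^bsub>board_ring m n\<^esub> {\<Prod>v\<in>F. var v | F. F \<in> facets (chessboard_complex m n)}"

end

theory Submission
  imports Defs
begin

text \<open>
  The facets of the chessboard complex are the placements of \<open>m\<close> rooks, one in each row, so the
  facet ideal is the edge ideal of a hypergraph. The minimal primes of an edge ideal are generated
  by the variables of the minimal covers of the hypergraph. For a cover \<open>C\<close> let the \<open>C\<close>-order of
  a polynomial be the least weight in \<open>C\<close> of one of its monomials. This order is additive because
  the polynomial ring is a domain (lemma \<open>mult_not_order_ge\<close>), so the powers of the prime of \<open>C\<close>,
  which are given by \<open>C\<close>-order at least \<open>t\<close>, are primary. Since the square-free ideal agrees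
  locally at the prime of \<open>C\<close> with that prime, the \<open>t\<close>-th symbolic power consists of the
  polynomials whose \<open>C\<close>-order is at least \<open>t\<close> for every minimal cover \<open>C\<close>
  (theorem \<open>symbolic_power_edge_ideal\<close>).

  Suppose that the colon of this ideal by \<open>f\<close> is prime. Then it is the prime of one minimal
  cover \<open>C\<close>, and comparing orders shows that some monomial \<open>e\<close> of \<open>f\<close> has weight exactly
  \<open>t - 1\<close> in \<open>C\<close> and at least \<open>t\<close> in all other minimal covers. Conversely, every such isolated
  exponent gives a colon ideal of this kind. The v-number is therefore the least degree of an
  isolated exponent (lemma \<open>v_number_J\<close>), a purely combinatorial quantity.

  By Hall's theorem the minimal covers are the rectangles \<open>R \<times> D\<close> with \<open>R\<close> a nonempty set of rows
  and \<open>card R + card D = n + 1\<close> (lemma \<open>min_covers_chessboard\<close>). Every row is such a rectangle.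
  The rows partition the board, so an isolated exponent has degree at least \<open>m * t - 1\<close>, and at
  least \<open>m * t\<close> if its exceptional rectangle is not a row. If \<open>n = m \<ge> 2\<close>, the columns are
  rectangles too, and an exceptional row is not a column, so that \<open>m * t\<close> is always a lower bound.

  Both bounds are attained, with the first row as the exceptional rectangle. Add \<open>t - 1\<close> copies of
  one rook placement and one copy of a second one: every rectangle then has weight at least \<open>t\<close>,
  because it meets every placement. Removing one rook from the first row leaves weight \<open>t - 1\<close>
  there, and the second placement is chosen such that the first row is the only rectangle that
  suffers (lemma \<open>first_row_only\<close>). On a square board the removed rook must be put back into the
  same column, as the columns have no weight to spare. For \<open>m = 1\<close> the whole board is the only
  rectangle, and all isolated exponents have degree \<open>t - 1\<close>.
\<close>

section \<open>Order of vanishing along a coordinate subspace\<close>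

definition weight :: "'v set \<Rightarrow> ('v \<Rightarrow>\<^sub>0 nat) \<Rightarrow> nat" where
  "weight C e = (\<Sum>v\<in>C. Poly_Mapping.lookup e v)"

lemma weight_add: "weight C (a + b) = weight C a + weight C b"
  by (simp add: weight_def lookup_add sum.distrib)

lemma weight_zero [simp]: "weight C 0 = 0"
  by (simp add: weight_def)

lemma weight_single:
  assumes "finite C"
  shows "weight C (Poly_Mapping.single v k) = (if v \<in> C then k else 0)"
  using assms by (simp add: weight_def lookup_single when_def)

lemma weight_pos_obtains:
  assumes "0 < weight C e"
  obtains v where "v \<in> C" "0 < Poly_Mapping.lookup e v"
  using assms unfolding weight_def by (metis not_gr_zero sum.neutral)

lemma exponent_split:
  assumes "0 < Poly_Mapping.lookup e v"
  obtains e' :: "'v \<Rightarrow>\<^sub>0 nat" where "e = Poly_Mapping.single v 1 + e'"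
proof
  show "e = Poly_Mapping.single v 1 + (e - Poly_Mapping.single v 1)"
    using assms by (intro poly_mapping_eqI) (auto simp: lookup_add lookup_minus lookup_single when_def)
qed

lemma keys_add_nat:
  "Poly_Mapping.keys (a + b) = Poly_Mapping.keys a \<union> Poly_Mapping.keys (b :: 'v \<Rightarrow>\<^sub>0 nat)"
  by (auto simp: in_keys_iff lookup_add)

text \<open>For a finite set \<open>C\<close> of variables this is the \<open>t\<close>-th power of the ideal that \<open>C\<close> generates, or
equally the set of polynomials that vanish to order at least \<open>t\<close> along the coordinate subspace
where the variables in \<open>C\<close> are zero.\<close>

definition order_ge :: "'v set \<Rightarrow> nat \<Rightarrow> (('v \<Rightarrow>\<^sub>0 nat) \<Rightarrow>\<^sub>0 'k::zero) set" where
  "order_ge C t = {f. \<forall>e\<in>Poly_Mapping.keys f. t \<le> weight C e}"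

lemma order_ge_0 [simp]: "f \<in> order_ge C 0"
  by (simp add: order_ge_def)

lemma zero_order_ge [simp]: "0 \<in> order_ge C t"
  by (simp add: order_ge_def)

lemma order_ge_antimono: "f \<in> order_ge C t \<Longrightarrow> s \<le> t \<Longrightarrow> f \<in> order_ge C s"
  by (force simp: order_ge_def)

lemma add_order_ge: "f \<in> order_ge C t \<Longrightarrow> g \<in> order_ge C t \<Longrightarrow> f + g \<in> order_ge C t"
  unfolding order_ge_def using keys_add[of f g] by blast

lemma mult_order_ge:
  "f \<in> order_ge C s \<Longrightarrow> g \<in> order_ge C t \<Longrightarrow> f * g \<in> order_ge C (s + t)"
  unfolding order_ge_def using keys_mult[of f g] by (force simp: weight_add intro: add_mono)

lemma single_order_ge:
  "Poly_Mapping.single e (1 :: 'k::zero_neq_one) \<in> order_ge C t \<longleftrightarrow> t \<le> weight C e"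
  by (simp add: order_ge_def)

text \<open>Splitting off the part of lowest weight lets additivity of the order be read off from the product
of two lowest forms, which cannot vanish in a domain.\<close>

lemma lowest_form:
  fixes f :: "('v \<Rightarrow>\<^sub>0 nat) \<Rightarrow>\<^sub>0 'k::comm_ring_1"
  assumes "f \<notin> order_ge C (Suc a)"
  obtains a' f0 f1 where "a' \<le> a" "f = f0 + f1" "f0 \<noteq> 0"
    "\<And>e. e \<in> Poly_Mapping.keys f0 \<Longrightarrow> weight C e = a'" "f1 \<in> order_ge C (Suc a')"
proof -
  define a' where "a' = Min (weight C ` Poly_Mapping.keys f)"
  from assms obtain e where e: "e \<in> Poly_Mapping.keys f" "weight C e \<le> a"
    by (auto simp: order_ge_def not_less_eq_eq)
  have a'_le: "a' \<le> weight C k" if "k \<in> Poly_Mapping.keys f" for k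
    unfolding a'_def using that by (intro Min_le) auto
  have "a' \<in> weight C ` Poly_Mapping.keys f"
    unfolding a'_def using e by (intro Min_in) auto
  then obtain k where k: "k \<in> Poly_Mapping.keys f" "weight C k = a'"
    by auto
  define f0 where "f0 = Poly_Mapping.mapp (\<lambda>k c. c when weight C k = a') f"
  define f1 where "f1 = Poly_Mapping.mapp (\<lambda>k c. c when weight C k \<noteq> a') f"
  show thesis
  proof
    show "a' \<le> a" using a'_le[OF e(1)] e(2) by simp
    show "f = f0 + f1"
      by (intro poly_mapping_eqI)
        (auto simp: f0_def f1_def lookup_add lookup_mapp when_def in_keys_iff)
    have "Poly_Mapping.lookup f0 k \<noteq> 0"
      using k by (simp add: f0_def lookup_mapp when_def in_keys_iff)
    then show "f0 \<noteq> 0" by auto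
    show "weight C e = a'" if "e \<in> Poly_Mapping.keys f0" for e
      using that by (auto simp: f0_def lookup_mapp when_def in_keys_iff split: if_splits)
    show "f1 \<in> order_ge C (Suc a')"
      using a'_le
      by (fastforce simp: order_ge_def f1_def lookup_mapp when_def in_keys_iff Suc_le_eq
        le_neq_implies_less split: if_splits)
  qed
qed

text \<open>The order of a product is at most the sum of the orders: the product of the lowest forms is
nonzero, and all other contributions to the product have larger weight.\<close>

lemma mult_not_order_ge:
  fixes f g :: "('v::linorder \<Rightarrow>\<^sub>0 nat) \<Rightarrow>\<^sub>0 'k::idom"
  assumes "f \<notin> order_ge C (Suc a)" "g \<notin> order_ge C (Suc b)"
  shows "f * g \<notin> order_ge C (Suc (a + b))"
proof -
  obtain a' f0 f1 where f: "a' \<le> a" "f = f0 + f1" "f0 \<noteq> 0"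
    "\<And>e. e \<in> Poly_Mapping.keys f0 \<Longrightarrow> weight C e = a'" "f1 \<in> order_ge C (Suc a')"
    using lowest_form[OF assms(1)] by metis
  obtain b' g0 g1 where g: "b' \<le> b" "g = g0 + g1" "g0 \<noteq> 0"
    "\<And>e. e \<in> Poly_Mapping.keys g0 \<Longrightarrow> weight C e = b'" "g1 \<in> order_ge C (Suc b')"
    using lowest_form[OF assms(2)] by metis
  have f0: "f0 \<in> order_ge C a'" and g0: "g0 \<in> order_ge C b'"
    using f(4) g(4) by (simp_all add: order_ge_def)
  have "g \<in> order_ge C b'"
    unfolding g(2) using g0 g(5) by (blast intro: add_order_ge order_ge_antimono le_SucI)
  then have rest: "f0 * g1 + f1 * g \<in> order_ge C (Suc (a' + b'))"
    using mult_order_ge[OF f0 g(5)] mult_order_ge[OF f(5)] by (simp add: add_order_ge)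
  from f(3) g(3) have "f0 * g0 \<noteq> 0" by simp
  then obtain k where k: "k \<in> Poly_Mapping.keys (f0 * g0)"
    by (metis keys_eq_empty ex_in_conv)
  then have wk: "weight C k = a' + b'"
    using keys_mult[of f0 g0] f(4) g(4) by (force simp: weight_add)
  then have "Poly_Mapping.lookup (f0 * g1 + f1 * g) k = 0"
    using rest by (force simp: order_ge_def in_keys_iff)
  moreover have "f * g = f0 * g0 + (f0 * g1 + f1 * g)"
    by (simp add: f(2) g(2) algebra_simps)
  ultimately have "k \<in> Poly_Mapping.keys (f * g)"
    using k by (simp add: in_keys_iff lookup_add)
  then show ?thesis
    using wk f(1) g(1) by (force simp: order_ge_def)
qed

text \<open>The powers of a prime generated by variables are primary. For \<open>t = 1\<close> this is the primality
itself.\<close>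

lemma order_ge_primary:
  fixes f g :: "('v::linorder \<Rightarrow>\<^sub>0 nat) \<Rightarrow>\<^sub>0 'k::idom"
  assumes "f * g \<in> order_ge C t" "g \<notin> order_ge C 1"
  shows "f \<in> order_ge C t"
  using assms mult_not_order_ge[of f C _ g 0] by (cases t) auto

lemma mult_single_order_ge:
  fixes f :: "('v::linorder \<Rightarrow>\<^sub>0 nat) \<Rightarrow>\<^sub>0 'k::idom"
  shows "f * Poly_Mapping.single e 1 \<in> order_ge C (t + weight C e) \<longleftrightarrow> f \<in> order_ge C t"
proof
  show "f * Poly_Mapping.single e 1 \<in> order_ge C (t + weight C e)" if "f \<in> order_ge C t"
    using that by (intro mult_order_ge) (simp_all add: single_order_ge)
next
  assume *: "f * Poly_Mapping.single e 1 \<in> order_ge C (t + weight C e)"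
  show "f \<in> order_ge C t"
  proof (cases t)
    case (Suc a)
    then show ?thesis
      using * mult_not_order_ge[of f C a "Poly_Mapping.single e 1" "weight C e"]
      by (auto simp: single_order_ge)
  qed simp
qed

lemma sum_of_terms:
  fixes f :: "'a \<Rightarrow>\<^sub>0 'b::comm_monoid_add"
  shows "(\<Sum>e\<in>Poly_Mapping.keys f. Poly_Mapping.single e (Poly_Mapping.lookup f e)) = f"
  by (intro poly_mapping_eqI)
    (auto simp: lookup_sum lookup_single when_def in_keys_iff)

text \<open>Monomial arguments suffice for membership in any additively closed set; in particular this is how
sets are handled that are not yet known to be ideals of the polynomial ring.\<close>

lemma closed_under_terms:
  fixes f :: "'a \<Rightarrow>\<^sub>0 'b::comm_monoid_add"
  assumes "0 \<in> J" "\<And>a b. a \<in> J \<Longrightarrow> b \<in> J \<Longrightarrow> a + b \<in> J"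
    and "\<And>e. e \<in> Poly_Mapping.keys f \<Longrightarrow> Poly_Mapping.single e (Poly_Mapping.lookup f e) \<in> J"
  shows "f \<in> J"
proof -
  have "(\<Sum>e\<in>S. Poly_Mapping.single e (Poly_Mapping.lookup f e)) \<in> J"
    if "finite S" "S \<subseteq> Poly_Mapping.keys f" for S
    using that by (induction) (auto intro: assms)
  from this[of "Poly_Mapping.keys f"] show ?thesis
    by (simp add: sum_of_terms)
qed

section \<open>Subrings of a domain and their localizations\<close>

text \<open>The condition under which \<open>ring_on A\<close> is a commutative ring. It is applied both to the polynomials
of the board and to the localizations, which are carriers inside a field of fractions.\<close>

definition closed_ring :: "'a::comm_ring_1 set \<Rightarrow> bool" where
  "closed_ring A \<longleftrightarrow> 0 \<in> A \<and> 1 \<in> A \<and> (\<forall>a\<in>A. \<forall>b\<in>A. a + b \<in> A \<and> a * b \<in> A) \<and> (\<forall>a\<in>A. - a \<in> A)"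

lemma ring_on_simps [simp]:
  "carrier (ring_on A) = A" "mult (ring_on A) = (*)" "one (ring_on A) = 1"
  "zero (ring_on A) = 0" "add (ring_on A) = (+)"
  by (simp_all add: ring_on_def)

lemma cring_ring_on:
  assumes "closed_ring A"
  shows "cring (ring_on A)"
proof (rule cringI)
  show "abelian_group (ring_on A)"
    using assms by (intro abelian_groupI) (auto simp: closed_ring_def algebra_simps intro!: bexI[of _ "- _"])
  show "comm_monoid (ring_on A)"
    using assms by (intro comm_monoidI) (auto simp: closed_ring_def algebra_simps)
qed (auto simp: algebra_simps)

lemma ideal_ring_onI:
  assumes A: "closed_ring A" and "J \<subseteq> A" "0 \<in> J"
    and add: "\<And>a b. a \<in> J \<Longrightarrow> b \<in> J \<Longrightarrow> a + b \<in> J"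
    and mult: "\<And>a x. a \<in> J \<Longrightarrow> x \<in> A \<Longrightarrow> x * a \<in> J"
  shows "ideal J (ring_on A)"
proof -
  interpret R: cring "ring_on A" using A by (rule cring_ring_on)
  show ?thesis
  proof (rule idealI)
    show "ring (ring_on A)" by (rule R.ring_axioms)
    show "subgroup J (add_monoid (ring_on A))"
    proof (rule R.add.subgroupI)
      fix a assume a: "a \<in> J"
      then have "a \<in> A" using assms(2) by blast
      then have "- a \<in> A" using A by (simp add: closed_ring_def)
      have "- a = \<ominus>\<^bsub>ring_on A\<^esub> a"
        using \<open>a \<in> A\<close> \<open>- a \<in> A\<close> R.minus_equality[of "- a" a] by simp
      moreover have "- a \<in> J"
        using mult[OF a, of "- 1"] A by (simp add: closed_ring_def)
      ultimately show "\<ominus>\<^bsub>ring_on A\<^esub> a \<in> J" by simp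
    qed (use assms(2,3) add in auto)
  qed (use mult in \<open>auto simp: mult.commute\<close>)
qed

lemma ideal_ring_onD:
  assumes "ideal J (ring_on A)"
  shows "J \<subseteq> A" "0 \<in> J" "\<And>a b. a \<in> J \<Longrightarrow> b \<in> J \<Longrightarrow> a + b \<in> J"
    "\<And>a x. a \<in> J \<Longrightarrow> x \<in> A \<Longrightarrow> x * a \<in> J"
proof -
  interpret ideal J "ring_on A" by fact
  show "J \<subseteq> A" "0 \<in> J" "\<And>a b. a \<in> J \<Longrightarrow> b \<in> J \<Longrightarrow> a + b \<in> J"
    "\<And>a x. a \<in> J \<Longrightarrow> x \<in> A \<Longrightarrow> x * a \<in> J"
    using a_subset additive_subgroup.zero_closed[OF is_additive_subgroup]
      additive_subgroup.a_closed[OF is_additive_subgroup] I_l_closed by auto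
qed

lemma prime_ring_onD:
  assumes "primeideal P (ring_on A)"
  shows "1 \<notin> P" "\<And>a b. a \<in> A \<Longrightarrow> b \<in> A \<Longrightarrow> a * b \<in> P \<Longrightarrow> a \<in> P \<or> b \<in> P"
proof -
  interpret primeideal P "ring_on A" by fact
  show "1 \<notin> P" using one_imp_carrier I_notcarr by auto
  show "\<And>a b. a \<in> A \<Longrightarrow> b \<in> A \<Longrightarrow> a * b \<in> P \<Longrightarrow> a \<in> P \<or> b \<in> P"
    using I_prime by auto
qed

lemma colon_ring_on: "colon (ring_on A) J f = {g \<in> A. g * f \<in> J}"
  by (simp add: colon_def)

text \<open>Passing from a class in the quotient to a representative turns annihilators into colon ideals.\<close>

lemma assoc_primes_ring_on:
  assumes A: "closed_ring A" and J: "ideal J (ring_on A)"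
  shows "assoc_primes (ring_on A) J =
    {P. primeideal P (ring_on A) \<and> (\<exists>f\<in>A. P = colon (ring_on A) J f)}"
proof -
  interpret R: cring "ring_on A" using A by (rule cring_ring_on)
  interpret J: ideal J "ring_on A" by fact
  have *: "{g \<in> A. (J +>\<^bsub>ring_on A\<^esub> g) \<otimes>\<^bsub>ring_on A Quot J\<^esub> (J +>\<^bsub>ring_on A\<^esub> f)
      = \<zero>\<^bsub>ring_on A Quot J\<^esub>} = colon (ring_on A) J f" if f: "f \<in> A" for f
  proof -
    have "(J +>\<^bsub>ring_on A\<^esub> g) \<otimes>\<^bsub>ring_on A Quot J\<^esub> (J +>\<^bsub>ring_on A\<^esub> f) = \<zero>\<^bsub>ring_on A Quot J\<^esub>
        \<longleftrightarrow> g * f \<in> J" if g: "g \<in> A" for g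
    proof -
      have gf: "g * f \<in> A" using A f g by (simp add: closed_ring_def)
      have "(J +>\<^bsub>ring_on A\<^esub> g) \<otimes>\<^bsub>ring_on A Quot J\<^esub> (J +>\<^bsub>ring_on A\<^esub> f) = J +>\<^bsub>ring_on A\<^esub> (g * f)"
        using J.rcoset_mult_add[of g f] f g by (simp add: FactRing_def)
      moreover have "\<zero>\<^bsub>ring_on A Quot J\<^esub> = J" by (simp add: FactRing_def)
      moreover have "J +>\<^bsub>ring_on A\<^esub> (g * f) = J \<longleftrightarrow> g * f \<in> J"
        using gf J.a_rcos_self[of "g * f"] J.a_rcos_const[of "g * f"] by auto
      ultimately show ?thesis by simp
    qed
    then show ?thesis by (auto simp: colon_ring_on)
  qed
  have "carrier (ring_on A Quot J) = (\<lambda>f. J +>\<^bsub>ring_on A\<^esub> f) ` A"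
    by (auto simp: FactRing_def A_RCOSETS_def')
  then show ?thesis
    by (simp add: assoc_primes_def * cong: conj_cong)
qed

lemma localization_closed:
  assumes A: "closed_ring A" and P: "primeideal P (ring_on A)"
  shows "closed_ring {Fract a b | a b. a \<in> A \<and> b \<in> A - P}"
proof -
  let ?L = "{Fract a b | a b. a \<in> A \<and> b \<in> A - P}"
  have P0: "0 \<in> P" using P ideal_ring_onD(2) by (auto dest: primeideal.axioms)
  note P1 = prime_ring_onD[OF P]
  have A': "0 \<in> A" "1 \<in> A" "\<And>a b. a \<in> A \<Longrightarrow> b \<in> A \<Longrightarrow> a + b \<in> A"
    "\<And>a b. a \<in> A \<Longrightarrow> b \<in> A \<Longrightarrow> a * b \<in> A" "\<And>a. a \<in> A \<Longrightarrow> - a \<in> A"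
    using A by (auto simp: closed_ring_def)
  have nz: "b \<noteq> 0" if "b \<in> A - P" for b using that P0 by auto
  have mem: "Fract a b \<in> ?L" if "a \<in> A" "b \<in> A - P" for a b using that by blast
  have prod: "b * d \<in> A - P" if "b \<in> A - P" "d \<in> A - P" for b d
    using that P1 A' by auto
  have "0 \<in> ?L" "1 \<in> ?L"
    using mem[of 0 1] mem[of 1 1] P1 A' by (auto simp: fract_collapse)
  moreover have "x + y \<in> ?L \<and> x * y \<in> ?L \<and> - x \<in> ?L" if x: "x \<in> ?L" and y: "y \<in> ?L" for x y
  proof -
    obtain a b where "x = Fract a b" "a \<in> A" "b \<in> A - P"
      using x by blast
    moreover obtain c d where "y = Fract c d" "c \<in> A" "d \<in> A - P"
      using y by blast
    ultimately show ?thesis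
      using mem[of "a * d + c * b" "b * d"] mem[of "a * c" "b * d"] mem[of "- a" b]
        prod[of b d] nz A' by auto
  qed
  ultimately show ?thesis unfolding closed_ring_def by blast
qed

text \<open>The fractions with numerator in \<open>J\<close> already form an ideal of the localization. This bounds an
extended ideal from above, and hence its contraction.\<close>

lemma extended_ideal_subset:
  assumes A: "closed_ring A" and P: "primeideal P (ring_on A)"
    and J: "ideal J (ring_on A)" and "I \<subseteq> J"
  shows "extended_ideal A P I \<subseteq> {Fract a b | a b. a \<in> J \<and> b \<in> A - P}"
proof -
  let ?L = "{Fract a b | a b. a \<in> A \<and> b \<in> A - P}"
  let ?K = "{Fract a b | a b. a \<in> J \<and> b \<in> A - P}"
  have P0: "0 \<in> P" using P ideal_ring_onD(2) by (auto dest: primeideal.axioms)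
  note P1 = prime_ring_onD[OF P]
  note J' = ideal_ring_onD[OF J]
  have A': "0 \<in> A" "1 \<in> A" "\<And>a b. a \<in> A \<Longrightarrow> b \<in> A \<Longrightarrow> a + b \<in> A"
    "\<And>a b. a \<in> A \<Longrightarrow> b \<in> A \<Longrightarrow> a * b \<in> A" "\<And>a. a \<in> A \<Longrightarrow> - a \<in> A"
    using A by (auto simp: closed_ring_def)
  have nz: "b \<noteq> 0" if "b \<in> A - P" for b using that P0 by auto
  have mem: "Fract a b \<in> ?K" if "a \<in> J" "b \<in> A - P" for a b using that by blast
  have prod: "b * d \<in> A - P" if "b \<in> A - P" "d \<in> A - P" for b d
    using that P1 A' by auto
  have one: "1 \<in> A - P" using P1 A' by auto
  have "ideal ?K (ring_on ?L)"
  proof (rule ideal_ring_onI[OF localization_closed[OF A P]])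
    show "?K \<subseteq> ?L" using J'(1) by blast
    show "0 \<in> ?K" using mem[OF J'(2) one] by (simp add: fract_collapse)
  next
    fix x y assume "x \<in> ?K" "y \<in> ?K"
    then obtain a b c d where x: "x = Fract a b" "a \<in> J" "b \<in> A - P"
      and y: "y = Fract c d" "c \<in> J" "d \<in> A - P" by blast
    have "a * d + c * b \<in> J"
      using x y J'(3) J'(4)[of a d] J'(4)[of c b] by (simp add: mult.commute)
    then show "x + y \<in> ?K"
      using mem[of "a * d + c * b" "b * d"] prod x y nz by simp
  next
    fix x y assume "x \<in> ?K" "y \<in> ?L"
    then obtain a b c d where x: "x = Fract a b" "a \<in> J" "b \<in> A - P"
      and y: "y = Fract c d" "c \<in> A" "d \<in> A - P" by blast
    then show "y * x \<in> ?K"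
      using mem[of "c * a" "d * b"] prod J'(4) by simp
  qed
  moreover have "(\<lambda>a. Fract a 1) ` I \<subseteq> ?K"
    using mem one assms(4) by blast
  ultimately show ?thesis
    unfolding extended_ideal_def localization_def genideal_def by blast
qed

text \<open>The contraction of an extended ideal is additively closed and contains every element that a
denominator multiplies into \<open>I\<close>. Membership is stated with a set comprehension so that
\<open>closed_under_terms\<close> applies to it.\<close>

lemma extended_ideal_contraction:
  assumes A: "closed_ring A" and P: "primeideal P (ring_on A)" and "I \<subseteq> A"
  shows "0 \<in> {f. Fract f 1 \<in> extended_ideal A P I}"
    and "\<lbrakk>f \<in> {f. Fract f 1 \<in> extended_ideal A P I}; g \<in> {f. Fract f 1 \<in> extended_ideal A P I}\<rbrakk>
      \<Longrightarrow> f + g \<in> {f. Fract f 1 \<in> extended_ideal A P I}"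
    and "\<lbrakk>f \<in> A; c \<in> A - P; c * f \<in> I\<rbrakk> \<Longrightarrow> f \<in> {f. Fract f 1 \<in> extended_ideal A P I}"
proof -
  let ?L = "{Fract a b | a b. a \<in> A \<and> b \<in> A - P}"
  note P1 = prime_ring_onD[OF P]
  have one: "1 \<in> A - P" using P1 A by (auto simp: closed_ring_def)
  interpret L: cring "ring_on ?L"
    by (intro cring_ring_on localization_closed A P)
  have sub: "(\<lambda>a. Fract a 1) ` I \<subseteq> ?L" using one assms(3) by blast
  have E: "ideal (extended_ideal A P I) (ring_on ?L)"
    unfolding extended_ideal_def localization_def using sub by (intro L.genideal_ideal) simp
  note E' = ideal_ring_onD[OF E]
  show "0 \<in> {f. Fract f 1 \<in> extended_ideal A P I}"
    using E'(2) by (simp add: fract_collapse)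
  show "f + g \<in> {f. Fract f 1 \<in> extended_ideal A P I}"
    if "f \<in> {f. Fract f 1 \<in> extended_ideal A P I}" "g \<in> {f. Fract f 1 \<in> extended_ideal A P I}"
    using that E'(3)[of "Fract f 1" "Fract g 1"] by simp
  show "f \<in> {f. Fract f 1 \<in> extended_ideal A P I}" if "f \<in> A" "c \<in> A - P" "c * f \<in> I"
  proof -
    have "c \<noteq> 0" using that(2) P ideal_ring_onD(2) by (auto dest: primeideal.axioms)
    have "Fract (c * f) 1 \<in> extended_ideal A P I"
      using that(3) L.genideal_self[of "(\<lambda>a. Fract a 1) ` I"] sub
      unfolding extended_ideal_def localization_def by auto
    moreover have "Fract 1 c \<in> ?L" using that(2) one by blast
    ultimately have "Fract 1 c * Fract (c * f) 1 \<in> extended_ideal A P I"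
      by (rule E'(4))
    moreover have "Fract 1 c * Fract (c * f) 1 = Fract f 1"
      using \<open>c \<noteq> 0\<close> by (simp add: eq_fract mult.commute)
    ultimately show ?thesis by simp
  qed
qed

section \<open>Symbolic powers of edge ideals of hypergraphs on the board\<close>

definition covers :: "'v set set \<Rightarrow> 'v set \<Rightarrow> bool" where
  "covers E C \<longleftrightarrow> (\<forall>F\<in>E. F \<inter> C \<noteq> {})"

definition min_covers :: "'v set \<Rightarrow> 'v set set \<Rightarrow> 'v set set" where
  "min_covers V E = {C. C \<subseteq> V \<and> covers E C \<and> (\<forall>D. D \<subset> C \<longrightarrow> \<not> covers E D)}"

lemma min_covers_minimal:
  "C \<in> min_covers V E \<Longrightarrow> covers E D \<Longrightarrow> D \<subseteq> C \<Longrightarrow> D = C"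
  unfolding min_covers_def by blast

lemma min_covers_exists:
  assumes "finite C" "C \<subseteq> V" "covers E C"
  shows "\<exists>D \<in> min_covers V E. D \<subseteq> C"
  using assms
proof (induction C rule: finite_psubset_induct)
  case (psubset C)
  show ?case
  proof (cases "\<exists>D. D \<subset> C \<and> covers E D")
    case True
    then obtain D where D: "D \<subset> C" "covers E D" by blast
    then have "\<exists>B \<in> min_covers V E. B \<subseteq> D"
      using psubset.IH[OF D(1)] psubset.prems(1) by simp
    then show ?thesis using D(1) by blast
  next
    case False
    then have "C \<in> min_covers V E" using psubset.prems unfolding min_covers_def by simp
    then show ?thesis by blast
  qed
qed

text \<open>This is where minimality of a cover is used algebraically: after inverting the other variables of
the edge, its monomial becomes the single variable \<open>v\<close>, so that locally the edge ideal is the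
whole prime of the cover.\<close>

lemma min_cover_private_edge:
  assumes "C \<in> min_covers V E" "v \<in> C"
  shows "\<exists>F\<in>E. F \<inter> C = {v}"
proof -
  have "C - {v} \<subset> C" using assms(2) by blast
  then have "\<not> covers E (C - {v})" and C: "covers E C" using assms(1) by (auto simp: min_covers_def)
  then obtain F where "F \<in> E" "F \<inter> (C - {v}) = {}" unfolding covers_def by blast
  moreover from this have "F \<inter> C \<noteq> {}" using C unfolding covers_def by blast
  ultimately show ?thesis by blast
qed

lemma finite_squares [simp]: "finite (squares m n)"
  by (simp add: squares_def)

lemma finite_cover: "C \<in> min_covers (squares m n) E \<Longrightarrow> finite C"
  unfolding min_covers_def using finite_subset[OF _ finite_squares] by blast

definition edge_monomial :: "(nat \<times> nat) set \<Rightarrow> 'k::field grid_poly" where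
  "edge_monomial F = (\<Prod>v\<in>F. var v)"

definition edge_ideal :: "nat \<Rightarrow> nat \<Rightarrow> (nat \<times> nat) set set \<Rightarrow> 'k::field grid_poly set" where
  "edge_ideal m n E = Idl\<^bsub>board_ring m n\<^esub> (edge_monomial ` E)"

lemma facet_ideal_eq_edge_ideal:
  "facet_ideal m n = edge_ideal m n (facets (chessboard_complex m n))"
  unfolding facet_ideal_def edge_ideal_def edge_monomial_def
  by (simp only: setcompr_eq_image Collect_mem_eq)

lemma closed_ring_board_poly: "closed_ring (board_poly m n :: 'k::field grid_poly set)"
proof -
  have "f + g \<in> board_poly m n" if "f \<in> board_poly m n" "g \<in> board_poly m n" for f g :: "'k grid_poly"
    using that keys_add[of f g] unfolding board_poly_def by blast
  moreover have "f * g \<in> board_poly m n"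
    if f: "f \<in> board_poly m n" and g: "g \<in> board_poly m n" for f g :: "'k grid_poly"
    unfolding board_poly_def
  proof (intro CollectI ballI)
    fix e assume "e \<in> Poly_Mapping.keys (f * g)"
    then obtain a b where "e = a + b" "a \<in> Poly_Mapping.keys f" "b \<in> Poly_Mapping.keys g"
      using keys_mult[of f g] by blast
    then show "Poly_Mapping.keys e \<subseteq> squares m n"
      using f g by (simp add: board_poly_def keys_add_nat)
  qed
  moreover have "- f \<in> board_poly m n" if "f \<in> board_poly m n" for f :: "'k grid_poly"
  proof -
    have "Poly_Mapping.keys (- f) = Poly_Mapping.keys f" by (auto simp only: in_keys_iff lookup_uminus neg_equal_0_iff_equal)
    then show ?thesis using that by (simp only: board_poly_def mem_Collect_eq)
  qed
  moreover have "0 \<in> board_poly m n" "1 \<in> board_poly m n" by (simp_all add: board_poly_def)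
  ultimately show ?thesis
    unfolding closed_ring_def by blast
qed

lemma var_in_board_poly: "v \<in> squares m n \<Longrightarrow> var v \<in> board_poly m n"
  by (simp add: board_poly_def var_def)

lemma var_order_ge:
  "finite C \<Longrightarrow> var v \<in> order_ge C t \<longleftrightarrow> t \<le> (if v \<in> C then 1 else 0)"
  by (simp add: var_def single_order_ge weight_single)

lemma prod_in_closed_ring:
  assumes "closed_ring A" "\<And>v. v \<in> F \<Longrightarrow> f v \<in> A"
  shows "(\<Prod>v\<in>F. f v) \<in> A"
  using assms(2)
proof (induction F rule: infinite_finite_induct)
qed (use assms(1) in \<open>auto simp: closed_ring_def\<close>)

lemma edge_monomial_in_board_poly: "F \<subseteq> squares m n \<Longrightarrow> edge_monomial F \<in> board_poly m n"
  unfolding edge_monomial_def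
  by (intro prod_in_closed_ring closed_ring_board_poly var_in_board_poly) blast

lemma edge_monomial_order_ge_iff:
  assumes "finite C" "finite F"
  shows "(edge_monomial F :: 'k::field grid_poly) \<in> order_ge C 1 \<longleftrightarrow> F \<inter> C \<noteq> {}"
  using assms(2)
proof (induction F)
  case empty
  show ?case by (simp add: edge_monomial_def order_ge_def)
next
  case (insert v F)
  have eq: "edge_monomial (insert v F) = var v * (edge_monomial F :: 'k grid_poly)"
    using insert.hyps by (simp add: edge_monomial_def)
  have v: "(var v :: 'k grid_poly) \<in> order_ge C 1 \<longleftrightarrow> v \<in> C"
    using assms(1) by (simp add: var_order_ge)
  show ?case
  proof
    assume *: "(edge_monomial (insert v F) :: 'k grid_poly) \<in> order_ge C 1"
    then show "insert v F \<inter> C \<noteq> {}"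
      using order_ge_primary[of "var v :: 'k grid_poly" "edge_monomial F" C 1] insert.IH v eq
      by auto
  next
    assume "insert v F \<inter> C \<noteq> {}"
    then have "(var v :: 'k grid_poly) \<in> order_ge C 1 \<or> (edge_monomial F :: 'k grid_poly) \<in> order_ge C 1"
      using v insert.IH by blast
    then show "(edge_monomial (insert v F) :: 'k grid_poly) \<in> order_ge C 1"
      unfolding eq using mult_order_ge[of "var v :: 'k grid_poly" C 1 "edge_monomial F" 0]
        mult_order_ge[of "var v :: 'k grid_poly" C 0 "edge_monomial F" 1] by auto
  qed
qed

definition board_order_ge ::
  "nat \<Rightarrow> nat \<Rightarrow> (nat \<times> nat) set \<Rightarrow> nat \<Rightarrow> 'k::field grid_poly set" where
  "board_order_ge m n C t = board_poly m n \<inter> order_ge C t"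

lemma ideal_board_order_ge:
  "ideal (board_order_ge m n C t :: 'k::field grid_poly set) (ring_on (board_poly m n))"
proof (rule ideal_ring_onI[OF closed_ring_board_poly])
  note cl = closed_ring_board_poly[of m n, where 'k = 'k, unfolded closed_ring_def]
  show "board_order_ge m n C t \<subseteq> (board_poly m n :: 'k grid_poly set)"
    by (simp add: board_order_ge_def)
  show "(0 :: 'k grid_poly) \<in> board_order_ge m n C t"
    using cl by (simp add: board_order_ge_def)
  show "a + b \<in> board_order_ge m n C t"
    if "a \<in> board_order_ge m n C t" "b \<in> board_order_ge m n C t" for a b :: "'k grid_poly"
    using that cl by (simp add: board_order_ge_def add_order_ge)
  show "x * a \<in> board_order_ge m n C t"
    if "a \<in> board_order_ge m n C t" "x \<in> board_poly m n" for a x :: "'k grid_poly"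
    using that cl mult_order_ge[of x C 0 a t] by (simp add: board_order_ge_def)
qed

lemma prime_board_order_ge:
  "primeideal (board_order_ge m n C 1 :: 'k::field grid_poly set) (ring_on (board_poly m n))"
proof (rule primeidealI)
  show "ideal (board_order_ge m n C 1 :: 'k grid_poly set) (ring_on (board_poly m n))"
    by (rule ideal_board_order_ge)
  show "cring (ring_on (board_poly m n :: 'k grid_poly set))"
    by (rule cring_ring_on[OF closed_ring_board_poly])
  have "(1 :: 'k grid_poly) \<in> board_poly m n"
    using closed_ring_board_poly[of m n, where 'k = 'k] by (simp add: closed_ring_def)
  moreover have "(1 :: 'k grid_poly) \<notin> order_ge C 1"
    by (simp add: order_ge_def)
  ultimately show "carrier (ring_on (board_poly m n)) \<noteq> (board_order_ge m n C 1 :: 'k grid_poly set)"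
    unfolding board_order_ge_def by auto
qed (use order_ge_primary in \<open>auto simp: board_order_ge_def\<close>)

text \<open>Every monomial with positive weight in \<open>C\<close> is divisible by a variable of \<open>C\<close>.\<close>

lemma board_order_ge_1_subset_prime:
  assumes Q: "ideal Q (ring_on (board_poly m n :: 'k::field grid_poly set))"
    and C: "\<And>v. v \<in> C \<Longrightarrow> var v \<in> Q"
  shows "board_order_ge m n C 1 \<subseteq> Q"
proof
  note Q' = ideal_ring_onD[OF Q]
  fix f :: "'k grid_poly" assume f: "f \<in> board_order_ge m n C 1"
  show "f \<in> Q"
  proof (rule closed_under_terms[OF Q'(2,3)])
    fix e assume e: "e \<in> Poly_Mapping.keys f"
    then have "0 < weight C e" using f by (force simp: board_order_ge_def order_ge_def)
    then obtain v where v: "v \<in> C" "0 < Poly_Mapping.lookup e v" by (rule weight_pos_obtains)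
    then obtain e' where e': "e = Poly_Mapping.single v 1 + e'" using exponent_split by metis
    have "Poly_Mapping.keys e \<subseteq> squares m n"
      using e f unfolding board_order_ge_def board_poly_def by blast
    then have "Poly_Mapping.keys e' \<subseteq> squares m n"
      by (simp add: e' keys_add_nat)
    then have "Poly_Mapping.single e' (Poly_Mapping.lookup f e) \<in> board_poly m n"
      by (simp add: board_poly_def)
    then have "Poly_Mapping.single e' (Poly_Mapping.lookup f e) * var v \<in> Q"
      using Q'(4) C v(1) by blast
    moreover have "Poly_Mapping.single e' (Poly_Mapping.lookup f e) * var v =
        Poly_Mapping.single e (Poly_Mapping.lookup f e)"
      by (simp add: var_def mult_single e' add.commute)
    ultimately show "Poly_Mapping.single e (Poly_Mapping.lookup f e) \<in> Q" by simp
  qed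
qed

lemma prime_contains_factor:
  assumes A: "closed_ring A" and Q: "primeideal Q (ring_on A)"
    and "\<And>v. v \<in> F \<Longrightarrow> f v \<in> A" and "(\<Prod>v\<in>F. f v) \<in> Q"
  shows "\<exists>v\<in>F. f v \<in> Q"
  using assms(3,4)
proof (induction F rule: infinite_finite_induct)
  case (insert v F)
  have "f v \<in> Q \<or> (\<Prod>v\<in>F. f v) \<in> Q"
    using insert.prems insert.hyps prod_in_closed_ring[OF A, of F f]
    by (intro prime_ring_onD(2)[OF Q]) auto
  then show ?case using insert by blast
qed (use prime_ring_onD(1)[OF Q] in auto)

text \<open>A prime that contains the monomial of an edge contains one of its variables, so the variables in a
prime over the edge ideal form a cover.\<close>

lemma prime_contains_min_cover:
  assumes E: "E \<subseteq> Pow (squares m n)"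
    and Q: "primeideal Q (ring_on (board_poly m n :: 'k::field grid_poly set))"
    and EQ: "edge_monomial ` E \<subseteq> Q"
  obtains C where "C \<in> min_covers (squares m n) E" "board_order_ge m n C 1 \<subseteq> Q"
proof -
  define C0 where "C0 = {v \<in> squares m n. (var v :: 'k grid_poly) \<in> Q}"
  have "covers E C0"
    unfolding covers_def
  proof
    fix F assume F: "F \<in> E"
    have "\<exists>v\<in>F. (var v :: 'k grid_poly) \<in> Q"
      using EQ F PowD[OF subsetD[OF E F]]
      by (intro prime_contains_factor[OF closed_ring_board_poly Q] var_in_board_poly)
        (auto simp: edge_monomial_def)
    then show "F \<inter> C0 \<noteq> {}" using PowD[OF subsetD[OF E F]] by (auto simp: C0_def)
  qed
  moreover have "C0 \<subseteq> squares m n" by (auto simp: C0_def)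
  ultimately obtain C where C: "C \<in> min_covers (squares m n) E" "C \<subseteq> C0"
    using min_covers_exists[of C0 "squares m n" E] finite_subset[OF _ finite_squares] by blast
  have "board_order_ge m n C 1 \<subseteq> Q"
    using C(2) by (intro board_order_ge_1_subset_prime primeideal.axioms(1)[OF Q]) (auto simp: C0_def)
  then show thesis using C(1) that by blast
qed

lemma edge_monomials_in_edge_ideal:
  assumes E: "E \<subseteq> Pow (squares m n)"
  shows "edge_monomial ` E \<subseteq> (edge_ideal m n E :: 'k::field grid_poly set)"
proof -
  interpret cring "ring_on (board_poly m n :: 'k grid_poly set)"
    by (rule cring_ring_on[OF closed_ring_board_poly])
  have "edge_monomial ` E \<subseteq> carrier (ring_on (board_poly m n :: 'k grid_poly set))"
    using E by (auto intro!: edge_monomial_in_board_poly)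
  then show ?thesis
    unfolding edge_ideal_def board_ring_def by (rule genideal_self)
qed

lemma edge_ideal_subset:
  assumes "ideal J (ring_on (board_poly m n))" "edge_monomial ` E \<subseteq> J"
  shows "edge_ideal m n E \<subseteq> J"
  unfolding edge_ideal_def board_ring_def genideal_def using assms by blast

lemma edge_ideal_subset_board_order_ge:
  assumes E: "E \<subseteq> Pow (squares m n)" and C: "C \<in> min_covers (squares m n) E"
  shows "edge_ideal m n E \<subseteq> (board_order_ge m n C 1 :: 'k::field grid_poly set)"
proof (rule edge_ideal_subset[OF ideal_board_order_ge], rule image_subsetI)
  fix F assume F: "F \<in> E"
  have "finite F" using PowD[OF subsetD[OF E F]] by (rule finite_subset) simp
  moreover have "F \<inter> C \<noteq> {}" using C F unfolding min_covers_def covers_def by blast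
  ultimately show "(edge_monomial F :: 'k grid_poly) \<in> board_order_ge m n C 1"
    using edge_monomial_order_ge_iff[OF finite_cover[OF C], of F]
      edge_monomial_in_board_poly[OF PowD[OF subsetD[OF E F]]]
    unfolding board_order_ge_def by blast
qed

lemma board_order_ge_1_subset_iff:
  assumes "C \<subseteq> squares m n" "D \<subseteq> squares m n"
  shows "(board_order_ge m n C 1 :: 'k::field grid_poly set) \<subseteq> board_order_ge m n D 1 \<longleftrightarrow> C \<subseteq> D"
proof
  have fin: "finite C" "finite D" using assms by (auto intro: finite_subset[OF _ finite_squares])
  assume *: "(board_order_ge m n C 1 :: 'k grid_poly set) \<subseteq> board_order_ge m n D 1"
  show "C \<subseteq> D"
  proof
    fix v assume v: "v \<in> C"
    then have "(var v :: 'k grid_poly) \<in> board_order_ge m n C 1"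
      using assms fin by (auto simp: board_order_ge_def var_order_ge var_in_board_poly)
    then have "(var v :: 'k grid_poly) \<in> order_ge D 1" using * by (auto simp: board_order_ge_def)
    then show "v \<in> D" using fin by (simp add: var_order_ge split: if_splits)
  qed
next
  have fin: "finite D" using assms by (auto intro: finite_subset[OF _ finite_squares])
  assume *: "C \<subseteq> D"
  show "(board_order_ge m n C 1 :: 'k grid_poly set) \<subseteq> board_order_ge m n D 1"
    using * assms(1) fin
    by (intro board_order_ge_1_subset_prime ideal_board_order_ge)
      (auto simp: board_order_ge_def var_order_ge var_in_board_poly)
qed

lemma min_primes_edge_ideal:
  assumes E: "E \<subseteq> Pow (squares m n)"
  shows "min_primes (ring_on (board_poly m n)) (edge_ideal m n E :: 'k::field grid_poly set) =
    (\<lambda>C. board_order_ge m n C 1) ` min_covers (squares m n) E"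
proof (intro equalityI subsetI)
  let ?I = "edge_ideal m n E :: 'k grid_poly set"
  let ?R = "ring_on (board_poly m n) :: 'k grid_poly ring"
  fix P assume P: "P \<in> min_primes ?R ?I"
  then have "primeideal P ?R" "edge_monomial ` E \<subseteq> P"
    using edge_monomials_in_edge_ideal[OF E, where 'k = 'k] unfolding min_primes_def by blast+
  then obtain C where C: "C \<in> min_covers (squares m n) E" "board_order_ge m n C 1 \<subseteq> P"
    using prime_contains_min_cover[OF E] by metis
  moreover have "?I \<subseteq> board_order_ge m n C 1"
    by (rule edge_ideal_subset_board_order_ge[OF E C(1)])
  ultimately have "P = board_order_ge m n C 1"
    using P prime_board_order_ge[of m n C] unfolding min_primes_def by blast
  then show "P \<in> (\<lambda>C. board_order_ge m n C 1) ` min_covers (squares m n) E"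
    using C(1) by blast
next
  let ?I = "edge_ideal m n E :: 'k grid_poly set"
  let ?R = "ring_on (board_poly m n) :: 'k grid_poly ring"
  fix P assume "P \<in> (\<lambda>C. board_order_ge m n C 1 :: 'k grid_poly set) ` min_covers (squares m n) E"
  then obtain C where C: "C \<in> min_covers (squares m n) E" and P: "P = board_order_ge m n C 1"
    by blast
  have "\<not> Q \<subset> P" if Q: "primeideal Q ?R" "?I \<subseteq> Q" for Q
  proof
    assume QP: "Q \<subset> P"
    have "edge_monomial ` E \<subseteq> Q"
      using edge_monomials_in_edge_ideal[OF E, where 'k = 'k] Q(2) by blast
    then obtain D where D: "D \<in> min_covers (squares m n) E" "board_order_ge m n D 1 \<subseteq> Q"
      using prime_contains_min_cover[OF E Q(1)] by metis
    then have "(board_order_ge m n D 1 :: 'k grid_poly set) \<subseteq> board_order_ge m n C 1"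
      using QP P by blast
    then have "D \<subseteq> C"
      using C D(1) by (subst (asm) board_order_ge_1_subset_iff) (auto simp: min_covers_def)
    then have "D = C" using min_covers_minimal[OF C] D(1) unfolding min_covers_def by blast
    then show False using D(2) QP P by blast
  qed
  then show "P \<in> min_primes ?R ?I"
    using prime_board_order_ge[of m n C, where 'k = 'k]
      edge_ideal_subset_board_order_ge[OF E C, where 'k = 'k]
    unfolding min_primes_def P by blast
qed

lemma ideal_power_0: "I [^]\<^bsub>ideals_set (ring_on A)\<^esub> (0::nat) = A"
  by (simp add: nat_pow_def ideals_set_def)

lemma ideal_power_Suc:
  "I [^]\<^bsub>ideals_set R\<^esub> (Suc k) = ideal_prod R (I [^]\<^bsub>ideals_set R\<^esub> k) I"
  by (simp add: nat_pow_def ideals_set_def)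

lemma edge_ideal_power_subset:
  assumes E: "E \<subseteq> Pow (squares m n)" and C: "C \<in> min_covers (squares m n) E"
  shows "edge_ideal m n E [^]\<^bsub>ideals_set (ring_on (board_poly m n))\<^esub> t
    \<subseteq> (board_order_ge m n C t :: 'k::field grid_poly set)"
proof (induction t)
  case 0
  show ?case unfolding ideal_power_0 by (auto simp: board_order_ge_def)
next
  case (Suc t)
  let ?I = "edge_ideal m n E :: 'k grid_poly set"
  let ?R = "ring_on (board_poly m n) :: 'k grid_poly ring"
  have cl: "a * b \<in> board_poly m n" if "a \<in> board_poly m n" "b \<in> board_poly m n" for a b :: "'k grid_poly"
    using that closed_ring_board_poly[of m n, where 'k = 'k] by (simp add: closed_ring_def)
  show ?case
    unfolding ideal_power_Suc
  proof
    fix f assume "f \<in> ideal_prod ?R (?I [^]\<^bsub>ideals_set ?R\<^esub> t) ?I"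
    then show "f \<in> board_order_ge m n C (Suc t)"
    proof induction
      case (prod i j)
      then have "i \<in> board_order_ge m n C t" "j \<in> board_order_ge m n C 1"
        using Suc.IH edge_ideal_subset_board_order_ge[OF E C, where 'k = 'k] by blast+
      then show ?case
        using mult_order_ge[of i C t j 1] cl by (simp add: board_order_ge_def)
    next
      case (sum a b)
      then show ?case
        using ideal_ring_onD(3)[OF ideal_board_order_ge[of m n C "Suc t", where 'k = 'k]] by simp
    qed
  qed
qed

text \<open>One variable of \<open>C\<close> is split off at a time; it is completed to the monomial of its private edge by a
factor that is free of \<open>C\<close>. The product of these factors is the denominator \<open>c\<close>.\<close>

lemma monomial_multiple_in_power:
  assumes E: "E \<subseteq> Pow (squares m n)" and C: "C \<in> min_covers (squares m n) E"
    and "Poly_Mapping.keys e \<subseteq> squares m n" "t \<le> weight C e"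
  shows "\<exists>c \<in> board_poly m n - board_order_ge m n C 1.
    c * Poly_Mapping.single e (a :: 'k::field) \<in>
      edge_ideal m n E [^]\<^bsub>ideals_set (ring_on (board_poly m n))\<^esub> t"
  using assms(3,4)
proof (induction t arbitrary: e)
  case 0
  have "1 \<in> board_poly m n - (board_order_ge m n C 1 :: 'k grid_poly set)"
    using closed_ring_board_poly[of m n, where 'k = 'k]
      prime_ring_onD(1)[OF prime_board_order_ge[of m n C, where 'k = 'k]]
    by (simp add: closed_ring_def)
  moreover have "Poly_Mapping.single e a \<in> board_poly m n"
    using 0 by (simp add: board_poly_def)
  ultimately show ?case
    unfolding ideal_power_0 by (intro bexI[of _ 1]) simp_all
next
  case (Suc t)
  let ?I = "edge_ideal m n E :: 'k grid_poly set"
  let ?R = "ring_on (board_poly m n) :: 'k grid_poly ring"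
  have finC: "finite C" by (rule finite_cover[OF C])
  obtain v where v: "v \<in> C" "0 < Poly_Mapping.lookup e v"
    using weight_pos_obtains[of C e] Suc.prems(2) by (metis Suc_le_D zero_less_Suc)
  then obtain e' where e: "e = Poly_Mapping.single v 1 + e'" using exponent_split by metis
  have "Poly_Mapping.keys e' \<subseteq> squares m n" "t \<le> weight C e'"
    using Suc.prems v(1) finC by (simp_all add: e keys_add_nat weight_add weight_single)
  then obtain c where c: "c \<in> board_poly m n - board_order_ge m n C 1"
    "c * Poly_Mapping.single e' a \<in> ?I [^]\<^bsub>ideals_set ?R\<^esub> t"
    using Suc.IH by blast
  obtain F where F: "F \<in> E" "F \<inter> C = {v}" using min_cover_private_edge[OF C v(1)] by blast
  have finF: "finite F" using PowD[OF subsetD[OF E F(1)]] by (rule finite_subset) simp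
  define b :: "'k grid_poly" where "b = edge_monomial (F - {v})"
  have "b \<in> board_poly m n"
    unfolding b_def using PowD[OF subsetD[OF E F(1)]] by (intro edge_monomial_in_board_poly) blast
  moreover have "b \<notin> order_ge C 1"
    unfolding b_def using F(2) finC finF by (subst edge_monomial_order_ge_iff) auto
  ultimately have b: "b \<in> board_poly m n - board_order_ge m n C 1" by (simp add: board_order_ge_def)
  have Fv: "edge_monomial F = var v * b"
    unfolding b_def edge_monomial_def using F(2) finF by (intro prod.remove) auto
  have "c * b \<in> board_poly m n - board_order_ge m n C 1"
    using b c(1) prime_ring_onD(2)[OF prime_board_order_ge[of m n C, where 'k = 'k], of c b]
      closed_ring_board_poly[of m n, where 'k = 'k] by (auto simp: closed_ring_def)
  moreover have "(c * b) * Poly_Mapping.single e a \<in> ?I [^]\<^bsub>ideals_set ?R\<^esub> (Suc t)"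
  proof -
    have "(c * b) * Poly_Mapping.single e a = (c * Poly_Mapping.single e' a) * edge_monomial F"
      by (simp add: Fv e var_def mult_single[of "Poly_Mapping.single v 1" 1 e' a, simplified, symmetric] mult_ac)
    also have "\<dots> \<in> ideal_prod ?R (?I [^]\<^bsub>ideals_set ?R\<^esub> t) ?I"
      using ideal_prod.prod[OF c(2), of "edge_monomial F" ?I ?R]
        edge_monomials_in_edge_ideal[OF E, where 'k = 'k] F(1) by auto
    finally show ?thesis unfolding ideal_power_Suc .
  qed
  ultimately show ?case by blast
qed

text \<open>Locally at the prime of a minimal cover, the power of the edge ideal is the power of that prime.
One inclusion clears denominators with primariness, the other treats each monomial separately.\<close>

lemma extended_power_contraction:
  assumes E: "E \<subseteq> Pow (squares m n)" and C: "C \<in> min_covers (squares m n) E"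
    and f: "(f :: 'k::field grid_poly) \<in> board_poly m n"
  shows "Fract f 1 \<in> extended_ideal (board_poly m n) (board_order_ge m n C 1)
      (edge_ideal m n E [^]\<^bsub>ideals_set (ring_on (board_poly m n))\<^esub> t) \<longleftrightarrow> f \<in> order_ge C t"
proof
  let ?A = "board_poly m n :: 'k grid_poly set"
  let ?P = "board_order_ge m n C 1 :: 'k grid_poly set"
  let ?It = "edge_ideal m n E [^]\<^bsub>ideals_set (ring_on ?A)\<^esub> t"
  note A = closed_ring_board_poly[of m n, where 'k = 'k]
    and P = prime_board_order_ge[of m n C, where 'k = 'k]
  have It: "?It \<subseteq> board_order_ge m n C t" by (rule edge_ideal_power_subset[OF E C])
  {
    assume "Fract f 1 \<in> extended_ideal ?A ?P ?It"
    then obtain a b where ab: "Fract f 1 = Fract a b" "a \<in> board_order_ge m n C t" "b \<in> ?A - ?P"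
      using extended_ideal_subset[OF A P ideal_board_order_ge It] by blast
    have "b \<noteq> 0" using ab(3) ideal_ring_onD(2)[OF ideal_board_order_ge[of m n C 1, where 'k = 'k]] by auto
    then have "f * b = a" using ab(1) by (simp add: eq_fract)
    then show "f \<in> order_ge C t"
      using ab(2,3) order_ge_primary[of f b C t] by (simp add: board_order_ge_def)
  next
    assume ft: "f \<in> order_ge C t"
    have "?It \<subseteq> ?A" using It by (auto simp: board_order_ge_def)
    note contr = extended_ideal_contraction[OF A P this]
    have "f \<in> {f. Fract f 1 \<in> extended_ideal ?A ?P ?It}"
    proof (rule closed_under_terms[OF contr(1,2)])
      fix e assume e: "e \<in> Poly_Mapping.keys f"
      then have "Poly_Mapping.keys e \<subseteq> squares m n" "t \<le> weight C e"
        using f ft by (auto simp: board_poly_def order_ge_def)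
      then obtain c where "c \<in> ?A - ?P" "c * Poly_Mapping.single e (Poly_Mapping.lookup f e) \<in> ?It"
        using monomial_multiple_in_power[OF E C] by blast
      moreover have "Poly_Mapping.single e (Poly_Mapping.lookup f e) \<in> ?A"
        using \<open>Poly_Mapping.keys e \<subseteq> squares m n\<close> by (simp add: board_poly_def)
      ultimately show "Poly_Mapping.single e (Poly_Mapping.lookup f e) \<in>
          {f. Fract f 1 \<in> extended_ideal ?A ?P ?It}" using contr(3) by blast
    qed
    then show "Fract f 1 \<in> extended_ideal ?A ?P ?It" by simp
  }
qed

theorem symbolic_power_edge_ideal:
  assumes E: "E \<subseteq> Pow (squares m n)"
  shows "symbolic_power (board_poly m n) (edge_ideal m n E :: 'k::field grid_poly set) t =
    {f \<in> board_poly m n. \<forall>C\<in>min_covers (squares m n) E. f \<in> order_ge C t}"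
  unfolding symbolic_power_def min_primes_edge_ideal[OF E]
  using extended_power_contraction[OF E] by auto

section \<open>Isolated exponents and the v-number\<close>

text \<open>The monomial \<open>e\<close> misses the ideal of all \<open>f\<close> with order at least \<open>t\<close> along every member of \<open>\<C>\<close>,
but only because of \<open>C\<close>, and there by the least possible amount. The family \<open>\<C>\<close> is a parameter so
that it can be given either as minimal covers or as rectangles.\<close>

definition isolated :: "'v set \<Rightarrow> 'v set set \<Rightarrow> nat \<Rightarrow> 'v set \<Rightarrow> ('v \<Rightarrow>\<^sub>0 nat) \<Rightarrow> bool" where
  "isolated V \<C> t C e \<longleftrightarrow> Poly_Mapping.keys e \<subseteq> V \<and> C \<in> \<C> \<and> Suc (weight C e) = t \<and>
    (\<forall>D\<in>\<C>. D \<noteq> C \<longrightarrow> t \<le> weight D e)"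

text \<open>The edge set is required to be nonempty because the empty hypergraph has the empty set as its
  minimal cover, along which no polynomial has positive finite order.\<close>

context
  fixes m n t :: nat and E :: "(nat \<times> nat) set set" and J :: "'k::field grid_poly set"
  assumes E: "E \<subseteq> Pow (squares m n)" and nonempty: "E \<noteq> {}" and t: "1 \<le> t"
  defines "J \<equiv> {f \<in> board_poly m n. \<forall>C\<in>min_covers (squares m n) E. f \<in> order_ge C t}"
begin

lemma ideal_J: "ideal J (ring_on (board_poly m n))"
proof -
  note I = ideal_ring_onD[OF ideal_board_order_ge[of m n _ t, where 'k = 'k]]
  show ?thesis
    using I(1)[of "{}"] I(2-4) closed_ring_board_poly[of m n, where 'k = 'k]
    by (intro ideal_ring_onI) (auto simp: J_def board_order_ge_def closed_ring_def)
qed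

lemma colon_of_isolated_monomial:
  assumes "isolated (squares m n) (min_covers (squares m n) E) t C e"
  shows "colon (ring_on (board_poly m n)) J (Poly_Mapping.single e 1) = board_order_ge m n C 1"
proof -
  have e: "(Poly_Mapping.single e 1 :: 'k grid_poly) \<in> board_poly m n"
    and C: "C \<in> min_covers (squares m n) E" and w: "t = 1 + weight C e"
    and other: "\<And>D. D \<in> min_covers (squares m n) E \<Longrightarrow> D \<noteq> C \<Longrightarrow> t \<le> weight D e"
    using assms by (auto simp: isolated_def board_poly_def)
  have "g * Poly_Mapping.single e 1 \<in> J \<longleftrightarrow> g \<in> order_ge C 1"
    if g: "g \<in> board_poly m n" for g :: "'k grid_poly"
  proof -
    have "g * Poly_Mapping.single e 1 \<in> board_poly m n"
      using closed_ring_board_poly[of m n, where 'k = 'k] g e by (simp add: closed_ring_def)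
    moreover have "g * Poly_Mapping.single e 1 \<in> order_ge D t"
      if "D \<in> min_covers (squares m n) E" "D \<noteq> C" for D
      using mult_order_ge[of g D 0 "Poly_Mapping.single e 1" t] other[OF that]
      by (simp add: single_order_ge)
    moreover have "g * Poly_Mapping.single e 1 \<in> order_ge C t \<longleftrightarrow> g \<in> order_ge C 1"
      unfolding w by (rule mult_single_order_ge)
    ultimately show ?thesis using C by (auto simp: J_def)
  qed
  then show ?thesis by (auto simp: colon_ring_on board_order_ge_def)
qed

text \<open>The colon ideal contains a power of each edge monomial, so as a prime it contains the prime of some
minimal cover \<open>C\<close>. On the other hand it lies in the prime of any cover \<open>D\<close> along which the order
of \<open>f\<close> is below \<open>t\<close>. Hence \<open>D = C\<close> is the only such cover, and multiplication by a variable of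
\<open>C\<close>, which raises the \<open>C\<close>-order by one, must repair it.\<close>

lemma isolated_of_prime_colon:
  assumes P: "primeideal P (ring_on (board_poly m n))" and f: "f \<in> board_poly m n"
    and P_eq: "colon (ring_on (board_poly m n)) J f = P"
  obtains C e where "isolated (squares m n) (min_covers (squares m n) E) t C e" "e \<in> Poly_Mapping.keys f"
    "P = board_order_ge m n C 1"
proof -
  note A = closed_ring_board_poly[of m n, where 'k = 'k, unfolded closed_ring_def]
  have memP: "g \<in> P \<longleftrightarrow> g \<in> board_poly m n \<and> (\<forall>C\<in>min_covers (squares m n) E. g * f \<in> order_ge C t)" for g
    using A f unfolding P_eq[symmetric] colon_ring_on J_def by blast
  \<comment> \<open>The \<open>t\<close>-th power of an edge monomial has order at least \<open>t\<close> along every cover.\<close>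
  have "edge_monomial ` E \<subseteq> P"
  proof (rule image_subsetI)
    fix F assume F: "F \<in> E"
    define x :: "'k grid_poly" where "x = edge_monomial F"
    have x: "x \<in> board_poly m n" unfolding x_def by (rule edge_monomial_in_board_poly[OF PowD[OF subsetD[OF E F]]])
    have pow: "x ^ k \<in> board_poly m n" for k by (induction k) (use A x in auto)
    have "x ^ k \<in> order_ge C k" if C: "C \<in> min_covers (squares m n) E" for C k
    proof (induction k)
      case (Suc k)
      have "x \<in> order_ge C 1"
        using edge_ideal_subset_board_order_ge[OF E C, where 'k = 'k]
          edge_monomials_in_edge_ideal[OF E, where 'k = 'k] F unfolding x_def board_order_ge_def by blast
      then show ?case using mult_order_ge[of x C 1 "x ^ k" k] Suc.IH by simp
    qed simp
    then have "x ^ t * f \<in> order_ge C t" if "C \<in> min_covers (squares m n) E" for C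
      using mult_order_ge[of "x ^ t" C t f 0] that by simp
    then have "x ^ t \<in> P" using memP pow by blast
    then have "x \<in> P"
    proof (induction t)
      case (Suc k)
      then show ?case using prime_ring_onD(2)[OF P x pow[of k]] by auto
    qed (use prime_ring_onD(1)[OF P] in simp)
    then show "edge_monomial F \<in> P" by (simp add: x_def)
  qed
  then obtain C where C: "C \<in> min_covers (squares m n) E" "board_order_ge m n C 1 \<subseteq> P"
    using prime_contains_min_cover[OF E P] by metis
  have sq: "D \<subseteq> squares m n" if "D \<in> min_covers (squares m n) E" for D
    using that unfolding min_covers_def by blast
  have "1 \<notin> P" by (rule prime_ring_onD(1)[OF P])
  then obtain D where D: "D \<in> min_covers (squares m n) E" "f \<notin> order_ge D t"
    using memP[of 1] A by auto
  have PD: "P \<subseteq> board_order_ge m n D 1"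
  proof
    fix g assume "g \<in> P"
    then have "g \<in> board_poly m n" "f * g \<in> order_ge D t" using memP D(1) by (auto simp: mult.commute)
    then show "g \<in> board_order_ge m n D 1"
      using order_ge_primary[of f g D t] D(2) by (auto simp: board_order_ge_def)
  qed
  have "C = D"
  proof (rule min_covers_minimal[OF D(1)])
    show "covers E C" using C(1) unfolding min_covers_def by blast
    show "C \<subseteq> D"
      using board_order_ge_1_subset_iff[OF sq[OF C(1)] sq[OF D(1)], where 'k = 'k] C(2) PD by blast
  qed
  then have P': "P = board_order_ge m n C 1" using C(2) PD by blast
  have var_mult: "var v * f \<in> order_ge D t" if "v \<in> C" "D \<in> min_covers (squares m n) E" for v D
  proof -
    have "(var v :: 'k grid_poly) \<in> P"
      using that(1) sq[OF C(1)] finite_cover[OF C(1)] unfolding P' board_order_ge_def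
      by (auto simp: var_order_ge var_in_board_poly)
    then show ?thesis using memP that(2) by blast
  qed
  \<comment> \<open>A variable in \<open>C\<close> outside \<open>D\<close> multiplies \<open>f\<close> into the ideal without changing its \<open>D\<close>-order.\<close>
  have others: "f \<in> order_ge D t" if D: "D \<in> min_covers (squares m n) E" "D \<noteq> C" for D
  proof -
    have "\<not> C \<subseteq> D" using min_covers_minimal[OF D(1)] D(2) C(1) unfolding min_covers_def by blast
    then obtain v where v: "v \<in> C" "v \<notin> D" by blast
    then have "(var v :: 'k grid_poly) \<notin> order_ge D 1"
      using finite_cover[OF D(1)] by (simp add: var_order_ge)
    then show ?thesis
      using order_ge_primary[of f "var v" D t] var_mult[OF v(1) D(1)] by (simp add: mult.commute)
  qed
  obtain s where s: "t = Suc s" using t by (cases t) auto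
  have "C \<noteq> {}" using C(1) nonempty unfolding min_covers_def covers_def by blast
  then obtain v where v: "v \<in> C" by blast
  have "f \<in> order_ge C s"
  proof (cases s)
    case (Suc a)
    have "(var v :: 'k grid_poly) \<notin> order_ge C (Suc 1)"
      using finite_cover[OF C(1)] by (simp add: var_order_ge)
    then show ?thesis
      using mult_not_order_ge[of "var v" C 1 f a] var_mult[OF v C(1)] by (auto simp: s Suc)
  qed simp
  moreover obtain e where e: "e \<in> Poly_Mapping.keys f" "weight C e < t"
    using D(2) \<open>C = D\<close> by (auto simp: order_ge_def not_le)
  ultimately have "Suc (weight C e) = t" unfolding order_ge_def s by force
  then have "isolated (squares m n) (min_covers (squares m n) E) t C e"
    using e(1) f C(1) others unfolding isolated_def board_poly_def order_ge_def by blast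
  then show thesis using that e(1) P' by blast
qed

text \<open>The infimum over the associated primes is taken of infima that could be over empty sets, where they
would be \<open>0\<close>. This does not happen: every associated prime comes from an isolated exponent, whose
monomial is homogeneous.\<close>

lemma v_number_J:
  assumes e0: "isolated (squares m n) (min_covers (squares m n) E) t C0 e0"
    and least: "\<And>C e. isolated (squares m n) (min_covers (squares m n) E) t C e \<Longrightarrow> mon_degree e0 \<le> mon_degree e"
  shows "v_number m n J = mon_degree e0"
proof -
  define T where "T P = {d. \<exists>f\<in>graded_part m n d. colon (board_ring m n) J f = P}" for P
  have Inf_T: "v_number_at m n J P = Inf (T P)" for P by (simp add: v_number_at_def T_def)
  have Ass: "P \<in> assoc_primes (board_ring m n) J \<longleftrightarrow>
      primeideal P (ring_on (board_poly m n)) \<and>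
        (\<exists>f\<in>board_poly m n. P = colon (ring_on (board_poly m n)) J f)" for P
    unfolding board_ring_def assoc_primes_ring_on[OF closed_ring_board_poly ideal_J] by simp
  have mon: "mon_degree e \<in> T (board_order_ge m n C 1)" if "isolated (squares m n) (min_covers (squares m n) E) t C e" for C e
  proof -
    have "(Poly_Mapping.single e 1 :: 'k grid_poly) \<in> graded_part m n (mon_degree e)"
      using that by (simp add: isolated_def graded_part_def board_poly_def)
    then show ?thesis
      unfolding T_def board_ring_def
      by (intro CollectI bexI[of _ "Poly_Mapping.single e 1"] colon_of_isolated_monomial[OF that])
  qed
  have lower: "mon_degree e0 \<le> v_number_at m n J P" if P: "P \<in> assoc_primes (board_ring m n) J" for P
  proof -
    have prime: "primeideal P (ring_on (board_poly m n))"
      using P[unfolded Ass] by (rule conjunct1)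
    obtain f where "f \<in> board_poly m n" "P = colon (ring_on (board_poly m n)) J f"
      using P[unfolded Ass] by (elim conjE bexE)
    from isolated_of_prime_colon[OF prime this(1) this(2)[symmetric]]
    obtain C e where "isolated (squares m n) (min_covers (squares m n) E) t C e" "P = board_order_ge m n C 1" .
    then have "T P \<noteq> {}" using mon[of C e] by auto
    then have "Inf (T P) \<in> T P" by (rule Inf_nat_def1)
    then have "\<exists>f\<in>graded_part m n (Inf (T P)). colon (board_ring m n) J f = P"
      unfolding T_def[of P] by (rule CollectD)
    then obtain f where f: "f \<in> graded_part m n (Inf (T P))" "colon (ring_on (board_poly m n)) J f = P"
      unfolding board_ring_def by (elim bexE)
    then have "f \<in> board_poly m n" by (simp add: graded_part_def)
    from isolated_of_prime_colon[OF prime this f(2)]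
    obtain C e where e: "isolated (squares m n) (min_covers (squares m n) E) t C e" "e \<in> Poly_Mapping.keys f" .
    then have "mon_degree e = Inf (T P)" using f(1) by (simp add: graded_part_def)
    then show ?thesis using least[OF e(1)] by (simp add: Inf_T)
  qed
  have P0: "board_order_ge m n C0 1 \<in> assoc_primes (board_ring m n) J"
  proof -
    have "(Poly_Mapping.single e0 1 :: 'k grid_poly) \<in> board_poly m n"
      using e0 by (simp add: isolated_def board_poly_def)
    then show ?thesis
      unfolding Ass
      by (intro conjI prime_board_order_ge bexI[of _ "Poly_Mapping.single e0 1"]
          colon_of_isolated_monomial[OF e0, symmetric])
  qed
  have "v_number_at m n J (board_order_ge m n C0 1) \<le> mon_degree e0"
    unfolding Inf_T using mon[OF e0] by (rule wellorder_Inf_le1)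
  then have eq: "v_number_at m n J (board_order_ge m n C0 1) = mon_degree e0"
    using lower[OF P0] by (rule antisym)
  have "mon_degree e0 \<in> v_number_at m n J ` assoc_primes (board_ring m n) J"
    using imageI[OF P0, of "v_number_at m n J"] unfolding eq .
  then show ?thesis
    unfolding v_number_def by (rule cInf_eq_minimum) (use lower in auto)
qed

end

section \<open>Hall's theorem and the minimal covers of the rook placements\<close>

text \<open>The usual induction: if some proper nonempty \<open>R\<close> is tight, match \<open>R\<close> and its complement
separately, the latter outside the neighbours of \<open>R\<close>; otherwise there is room to assign any
neighbour \<open>c\<close> to one element \<open>i\<close>.\<close>

lemma hall_marriage:
  fixes N :: "'a \<Rightarrow> 'b set"
  assumes "finite I" and "\<And>i. i \<in> I \<Longrightarrow> finite (N i)"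
    and "\<And>R. R \<subseteq> I \<Longrightarrow> card R \<le> card (\<Union>i\<in>R. N i)"
  shows "\<exists>\<sigma>. inj_on \<sigma> I \<and> (\<forall>i\<in>I. \<sigma> i \<in> N i)"
  using assms
proof (induction "card I" arbitrary: I N rule: less_induct)
  case less
  show ?case
  proof (cases "I = {}")
    case False
    then obtain i where i: "i \<in> I" by blast
    show ?thesis
    proof (cases "\<exists>R. R \<subset> I \<and> R \<noteq> {} \<and> card R = card (\<Union>i\<in>R. N i)")
      case True
      then obtain R where R: "R \<subset> I" "R \<noteq> {}" and tight: "card R = card (\<Union>i\<in>R. N i)"
        by blast
      have finR: "finite R" using R less.prems(1) by (meson finite_subset psubset_imp_subset)
      define U where "U = (\<Union>i\<in>R. N i)"
      have finU: "finite U" unfolding U_def using finR R less.prems(2) by auto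
      have "\<exists>\<sigma>. inj_on \<sigma> R \<and> (\<forall>i\<in>R. \<sigma> i \<in> N i)"
      proof (rule less.hyps)
        show "card R < card I" using R less.prems(1) by (simp add: psubset_card_mono)
      qed (use R finR less.prems in auto)
      then obtain \<sigma> where \<sigma>: "inj_on \<sigma> R" "\<And>i. i \<in> R \<Longrightarrow> \<sigma> i \<in> N i" by blast
      have "\<exists>\<tau>. inj_on \<tau> (I - R) \<and> (\<forall>i\<in>I - R. \<tau> i \<in> N i - U)"
      proof (rule less.hyps)
        show "card (I - R) < card I"
          using R less.prems(1) by (intro psubset_card_mono) auto
        show "card T \<le> card (\<Union>i\<in>T. N i - U)" if T: "T \<subseteq> I - R" for T
        proof -
          have finT: "finite T" using T less.prems(1) by (meson finite_Diff finite_subset)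
          have finN: "finite (\<Union>i\<in>T. N i - U)" using finT T less.prems(2) by auto
          have "card T + card R = card (T \<union> R)"
            using T finT finR by (subst card_Un_disjoint) auto
          also have "\<dots> \<le> card (\<Union>i\<in>T \<union> R. N i)"
            using T R by (intro less.prems(3)) auto
          also have "(\<Union>i\<in>T \<union> R. N i) = (\<Union>i\<in>T. N i - U) \<union> U"
            by (auto simp: U_def)
          also have "card \<dots> = card (\<Union>i\<in>T. N i - U) + card U"
            using finN finU by (subst card_Un_disjoint) auto
          finally show ?thesis using tight by (simp add: U_def)
        qed
      qed (use less.prems in auto)
      then obtain \<tau> where \<tau>: "inj_on \<tau> (I - R)" "\<And>i. i \<in> I - R \<Longrightarrow> \<tau> i \<in> N i - U" by blast
      have "\<sigma> i \<in> U" if "i \<in> R" for i using \<sigma>(2) that by (auto simp: U_def)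
      then have clash: "\<sigma> i \<noteq> \<tau> j" if "i \<in> R" "j \<in> I - R" for i j
        using \<tau>(2) that by fastforce
      have "inj_on (\<lambda>i. if i \<in> R then \<sigma> i else \<tau> i) I"
      proof (rule inj_onI)
        fix x y assume "x \<in> I" "y \<in> I"
          and eq: "(if x \<in> R then \<sigma> x else \<tau> x) = (if y \<in> R then \<sigma> y else \<tau> y)"
        then show "x = y"
          using \<sigma>(1) \<tau>(1) clash[of x y] clash[of y x]
          by (cases "x \<in> R"; cases "y \<in> R") (auto dest: inj_onD)
      qed
      then show ?thesis
        using \<sigma>(2) \<tau>(2) by (intro exI[of _ "\<lambda>i. if i \<in> R then \<sigma> i else \<tau> i"]) auto
    next
      case False
      have "N i \<noteq> {}" using less.prems(3)[of "{i}"] i by auto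
      then obtain c where c: "c \<in> N i" by blast
      have "\<exists>\<tau>. inj_on \<tau> (I - {i}) \<and> (\<forall>j\<in>I - {i}. \<tau> j \<in> N j - {c})"
      proof (rule less.hyps)
        show "card (I - {i}) < card I" using i less.prems(1) by (meson card_Diff1_less)
        show "card T \<le> card (\<Union>j\<in>T. N j - {c})" if T: "T \<subseteq> I - {i}" for T
        proof (cases "T = {}")
          case nonempty: False
          have finT: "finite T" using T less.prems(1) by (meson finite_Diff finite_subset)
          have "T \<subset> I" using T i by blast
          then have "card T \<noteq> card (\<Union>j\<in>T. N j)" using False nonempty by blast
          then have "card T < card (\<Union>j\<in>T. N j)"
            using less.prems(3)[of T] \<open>T \<subset> I\<close> by force
          moreover have "(\<Union>j\<in>T. N j - {c}) = (\<Union>j\<in>T. N j) - {c}" by auto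
          moreover have "card (\<Union>j\<in>T. N j) - 1 \<le> card ((\<Union>j\<in>T. N j) - {c})"
            using diff_card_le_card_Diff[of "{c}" "\<Union>j\<in>T. N j"] by simp
          ultimately show ?thesis by simp
        qed simp
      qed (use less.prems in auto)
      then obtain \<tau> where "inj_on \<tau> (I - {i})" "\<And>j. j \<in> I - {i} \<Longrightarrow> \<tau> j \<in> N j - {c}" by blast
      then show ?thesis
        using c by (intro exI[of _ "\<tau>(i := c)"]) (auto simp: inj_on_def)
    qed
  qed simp
qed

lemma chessboard_complexD:
  assumes "F \<in> chessboard_complex m n"
  shows "F \<subseteq> {1..m} \<times> {1..n}"
    and "(i, j) \<in> F \<Longrightarrow> (i, j') \<in> F \<Longrightarrow> j = j'"
    and "(i, j) \<in> F \<Longrightarrow> (i', j) \<in> F \<Longrightarrow> i = i'"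
proof -
  show "F \<subseteq> {1..m} \<times> {1..n}"
    using assms unfolding chessboard_complex_def squares_def by blast
  have *: "a = b" if "a \<in> F" "b \<in> F" "fst a = fst b \<or> snd a = snd b" for a b
    using assms that unfolding chessboard_complex_def by blast
  show "(i, j) \<in> F \<Longrightarrow> (i, j') \<in> F \<Longrightarrow> j = j'"
    using *[of "(i, j)" "(i, j')"] by simp
  show "(i, j) \<in> F \<Longrightarrow> (i', j) \<in> F \<Longrightarrow> i = i'"
    using *[of "(i, j)" "(i', j)"] by simp
qed

lemma rook_placement_facet:
  assumes "inj_on \<sigma> {1..m}" "\<And>i. i \<in> {1..m} \<Longrightarrow> \<sigma> i \<in> {1..n}"
  shows "(\<lambda>i. (i, \<sigma> i)) ` {1..m} \<in> facets (chessboard_complex m n)"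
proof -
  have "(\<lambda>i. (i, \<sigma> i)) ` {1..m} \<in> chessboard_complex m n"
    unfolding chessboard_complex_def squares_def
  proof (intro CollectI conjI)
    show "(\<lambda>i. (i, \<sigma> i)) ` {1..m} \<subseteq> {1..m} \<times> {1..n}" using assms(2) by blast
    show "\<forall>a\<in>(\<lambda>i. (i, \<sigma> i)) ` {1..m}. \<forall>b\<in>(\<lambda>i. (i, \<sigma> i)) ` {1..m}.
        a \<noteq> b \<longrightarrow> fst a \<noteq> fst b \<and> snd a \<noteq> snd b"
      using inj_onD[OF assms(1)] by fastforce
  qed
  moreover have "G = (\<lambda>i. (i, \<sigma> i)) ` {1..m}"
    if G: "G \<in> chessboard_complex m n" "(\<lambda>i. (i, \<sigma> i)) ` {1..m} \<subseteq> G" for G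
  proof -
    have "(i, j) \<in> (\<lambda>i. (i, \<sigma> i)) ` {1..m}" if v: "(i, j) \<in> G" for i j
    proof -
      have i: "i \<in> {1..m}" using chessboard_complexD(1)[OF G(1)] v by blast
      then have "(i, \<sigma> i) \<in> G" using G(2) by blast
      then have "j = \<sigma> i" using chessboard_complexD(2)[OF G(1) v] by blast
      then show ?thesis using i by blast
    qed
    then have "G \<subseteq> (\<lambda>i. (i, \<sigma> i)) ` {1..m}" by auto
    then show ?thesis using G(2) by blast
  qed
  ultimately show ?thesis unfolding facets_def by blast
qed

text \<open>If a row is free, there are fewer than \<open>m \<le> n\<close> rooks, so a column is free as well and the square
where they cross can be added.\<close>

lemma facet_meets_every_row:
  assumes "m \<le> n" and F: "F \<in> facets (chessboard_complex m n)" and i: "i \<in> {1..m}"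
  shows "\<exists>j. (i, j) \<in> F"
proof (rule ccontr)
  assume no: "\<nexists>j. (i, j) \<in> F"
  have F': "F \<in> chessboard_complex m n" using F by (simp add: facets_def)
  note F1 = chessboard_complexD(1)[OF F'] and F2 = chessboard_complexD(2)[OF F']
    and F3 = chessboard_complexD(3)[OF F']
  have finF: "finite F" using F1 by (rule finite_subset) simp
  have "card (snd ` F) \<le> card F" using finF by (rule card_image_le)
  also have "card F = card (fst ` F)"
  proof (intro card_image[symmetric] inj_onI)
    fix x y assume "x \<in> F" "y \<in> F" "fst x = fst y"
    then show "x = y" using F2[of "fst x" "snd x" "snd y"] by (metis prod.collapse)
  qed
  also have "\<dots> \<le> card ({1..m} - {i})"
  proof (rule card_mono)
    show "fst ` F \<subseteq> {1..m} - {i}" using F1 no by force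
  qed simp
  also have "\<dots> < n" using i assms(1) by auto
  finally have "card (snd ` F) < card {1..n}" by simp
  then have "\<not> {1..n} \<subseteq> snd ` F"
    using finF by (meson card_mono finite_imageI leD)
  then obtain j where j: "j \<in> {1..n}" "j \<notin> snd ` F" by blast
  have new: "fst b \<noteq> i \<and> snd b \<noteq> j" if "b \<in> F" for b
    using that no j(2) by (metis image_eqI prod.collapse)
  have "insert (i, j) F \<in> chessboard_complex m n"
    unfolding chessboard_complex_def
  proof (intro CollectI conjI)
    show "insert (i, j) F \<subseteq> squares m n"
      using F1 i j(1) by (simp add: squares_def)
    have "fst a \<noteq> fst b \<and> snd a \<noteq> snd b" if "a \<in> F" "b \<in> F" "a \<noteq> b" for a b
      using F' that unfolding chessboard_complex_def by blast
    then show "\<forall>a\<in>insert (i, j) F. \<forall>b\<in>insert (i, j) F. a \<noteq> b \<longrightarrow> fst a \<noteq> fst b \<and> snd a \<noteq> snd b"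
      using new by (simp add: eq_commute)
  qed
  moreover have "F \<subset> insert (i, j) F" using no by blast
  ultimately show False using F by (auto simp: facets_def)
qed

text \<open>The rooks in the rows \<open>R\<close> stand in \<open>card R\<close> different columns, too many to avoid \<open>D\<close>.\<close>

lemma rectangle_covers:
  assumes "m \<le> n" "R \<subseteq> {1..m}" "D \<subseteq> {1..n}" "card R + card D = n + 1"
  shows "covers (facets (chessboard_complex m n)) (R \<times> D)"
  unfolding covers_def
proof
  fix F assume F: "F \<in> facets (chessboard_complex m n)"
  then have F': "F \<in> chessboard_complex m n" by (simp add: facets_def)
  have "\<forall>i\<in>R. \<exists>j. (i, j) \<in> F" using facet_meets_every_row[OF assms(1) F] assms(2) by blast
  then obtain \<sigma> where \<sigma>: "\<And>i. i \<in> R \<Longrightarrow> (i, \<sigma> i) \<in> F" by metis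
  have "inj_on \<sigma> R" using \<sigma> chessboard_complexD(3)[OF F'] by (intro inj_onI) metis
  then have "card (\<sigma> ` R) = card R" by (rule card_image)
  have sub: "\<sigma> ` R \<subseteq> {1..n}" using \<sigma> chessboard_complexD(1)[OF F'] by blast
  have "\<sigma> ` R \<inter> D \<noteq> {}"
  proof
    assume "\<sigma> ` R \<inter> D = {}"
    then have "card (\<sigma> ` R \<union> D) = n + 1"
      using sub assms \<open>card (\<sigma> ` R) = card R\<close>
      by (subst card_Un_disjoint) (auto intro: finite_subset)
    moreover have "card (\<sigma> ` R \<union> D) \<le> card {1..n}"
      using sub assms(3) by (intro card_mono) auto
    ultimately show False by simp
  qed
  then show "F \<inter> R \<times> D \<noteq> {}" using \<sigma> by blast
qed

text \<open>The squares outside \<open>C\<close> contain no full rook placement. By Hall's theorem some set \<open>R\<close> of rows has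
fewer than \<open>card R\<close> columns available outside \<open>C\<close>; the remaining columns meet \<open>R\<close> only in \<open>C\<close>.\<close>

lemma cover_contains_rectangle:
  assumes "m \<le> n" "covers (facets (chessboard_complex m n)) C"
  obtains R D where "R \<subseteq> {1..m}" "D \<subseteq> {1..n}" "R \<noteq> {}" "card R + card D = n + 1" "R \<times> D \<subseteq> C"
proof -
  define N where "N i = {j \<in> {1..n}. (i, j) \<notin> C}" for i
  have "\<not> (\<exists>\<sigma>. inj_on \<sigma> {1..m} \<and> (\<forall>i\<in>{1..m}. \<sigma> i \<in> N i))"
  proof
    assume "\<exists>\<sigma>. inj_on \<sigma> {1..m} \<and> (\<forall>i\<in>{1..m}. \<sigma> i \<in> N i)"
    then obtain \<sigma> where \<sigma>: "inj_on \<sigma> {1..m}" "\<And>i. i \<in> {1..m} \<Longrightarrow> \<sigma> i \<in> N i" by blast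
    then have "(\<lambda>i. (i, \<sigma> i)) ` {1..m} \<in> facets (chessboard_complex m n)"
      unfolding N_def by (intro rook_placement_facet) blast+
    then have "(\<lambda>i. (i, \<sigma> i)) ` {1..m} \<inter> C \<noteq> {}"
      using assms unfolding covers_def by blast
    then obtain i where "i \<in> {1..m}" "(i, \<sigma> i) \<in> C" by blast
    then show False using \<sigma>(2)[of i] by (simp add: N_def)
  qed
  moreover have "finite (N i)" for i by (simp add: N_def)
  ultimately have "\<not> (\<forall>R. R \<subseteq> {1..m} \<longrightarrow> card R \<le> card (\<Union>i\<in>R. N i))"
    using hall_marriage[of "{1..m}" N] by (meson finite_atLeastAtMost)
  then obtain R where R: "R \<subseteq> {1..m}" and less: "card (\<Union>i\<in>R. N i) < card R"
    using not_le by blast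
  have "(\<Union>i\<in>R. N i) \<subseteq> {1..n}" by (auto simp: N_def)
  then have "card ({1..n} - (\<Union>i\<in>R. N i)) = n - card (\<Union>i\<in>R. N i)"
    by (subst card_Diff_subset) (auto intro: finite_subset)
  then have "n + 1 - card R \<le> card ({1..n} - (\<Union>i\<in>R. N i))" using less by linarith
  then obtain D where D: "D \<subseteq> {1..n} - (\<Union>i\<in>R. N i)" "card D = n + 1 - card R"
    by (metis obtain_subset_with_card_n)
  have "card R \<le> m" using card_mono[OF _ R] by simp
  then have "card R + card D = n + 1" using D(2) assms(1) by simp
  moreover have "R \<noteq> {}" using less by auto
  moreover have "D \<subseteq> {1..n}" "R \<times> D \<subseteq> C" using D(1) unfolding N_def by blast+
  ultimately show thesis using R that by blast
qed

definition cover_rectangles :: "nat \<Rightarrow> nat \<Rightarrow> (nat \<times> nat) set set" where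
  "cover_rectangles m n =
    {R \<times> D | R D. R \<subseteq> {1..m} \<and> D \<subseteq> {1..n} \<and> R \<noteq> {} \<and> card R + card D = n + 1}"

text \<open>Rectangles of the given size are covers and every cover contains one. They are minimal because
none of them contains another: the sum of the two side lengths is constant.\<close>

lemma min_covers_chessboard:
  assumes "m \<le> n"
  shows "min_covers (squares m n) (facets (chessboard_complex m n)) = cover_rectangles m n"
proof (intro equalityI subsetI)
  let ?E = "facets (chessboard_complex m n)"
  fix C assume C: "C \<in> min_covers (squares m n) ?E"
  then have "covers ?E C" unfolding min_covers_def by blast
  then obtain R D where RD: "R \<subseteq> {1..m}" "D \<subseteq> {1..n}" "R \<noteq> {}" "card R + card D = n + 1" "R \<times> D \<subseteq> C"
    using cover_contains_rectangle[OF assms] by metis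
  then have "C = R \<times> D"
    using min_covers_minimal[OF C rectangle_covers[OF assms RD(1,2,4)] RD(5)] by simp
  then show "C \<in> cover_rectangles m n" using RD unfolding cover_rectangles_def by blast
next
  let ?E = "facets (chessboard_complex m n)"
  fix C assume "C \<in> cover_rectangles m n"
  then obtain R D where C: "C = R \<times> D" and RD: "R \<subseteq> {1..m}" "D \<subseteq> {1..n}" "R \<noteq> {}"
      "card R + card D = n + 1" unfolding cover_rectangles_def by blast
  have fin: "finite R" "finite D" using RD by (auto intro: finite_subset)
  have "\<not> covers ?E B" if B: "B \<subset> C" for B
  proof
    assume "covers ?E B"
    then obtain R' D' where RD': "R' \<subseteq> {1..m}" "D' \<subseteq> {1..n}" "R' \<noteq> {}"
        "card R' + card D' = n + 1" "R' \<times> D' \<subseteq> B"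
      using cover_contains_rectangle[OF assms] by metis
    have "card R' \<le> m" using card_mono[OF _ RD'(1)] by simp
    then have "D' \<noteq> {}" using RD'(4) assms by auto
    moreover have "R' \<times> D' \<subseteq> R \<times> D" using RD'(5) B C by blast
    ultimately have sub: "R' \<subseteq> R" "D' \<subseteq> D" using RD'(3) by (simp_all add: times_subset_iff)
    then have "card R' \<le> card R" "card D' \<le> card D" using fin by (simp_all add: card_mono)
    then have "card R' = card R" "card D' = card D" using RD(4) RD'(4) by linarith+
    then have "R' = R" "D' = D" using sub fin by (simp_all add: card_subset_eq)
    then show False using RD'(5) B C by blast
  qed
  moreover have "C \<subseteq> squares m n" using RD(1,2) C by (auto simp: squares_def)
  ultimately show "C \<in> min_covers (squares m n) ?E"
    using rectangle_covers[OF assms RD(1,2,4)] C unfolding min_covers_def by blast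
qed

section \<open>Degrees of isolated exponents on the chessboard\<close>

lemma mon_degree_eq_weight:
  "Poly_Mapping.keys e \<subseteq> squares m n \<Longrightarrow> mon_degree e = weight (squares m n) e"
  unfolding mon_degree_def weight_def
  by (rule sum.mono_neutral_left) (auto simp: in_keys_iff)

lemma weight_times: "weight (R \<times> D) e = (\<Sum>i\<in>R. \<Sum>j\<in>D. Poly_Mapping.lookup e (i, j))"
  by (simp add: weight_def sum.cartesian_product)

lemma weight_rows: "weight (R \<times> D) e = (\<Sum>i\<in>R. weight ({i} \<times> D) e)"
  by (simp add: weight_times)

lemma weight_columns: "weight (R \<times> D) e = (\<Sum>j\<in>D. weight (R \<times> {j}) e)"
  unfolding weight_times by (subst sum.swap) simp

lemma sum_ge_card_mult:
  fixes f :: "'a \<Rightarrow> nat"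
  assumes "finite I" "i0 \<in> I" "Suc (f i0) = t" "\<And>i. i \<in> I \<Longrightarrow> i \<noteq> i0 \<Longrightarrow> t \<le> f i"
  shows "card I * t - 1 \<le> sum f I"
proof -
  have "card (I - {i0}) * t \<le> sum f (I - {i0})"
    using sum_bounded_below[of "I - {i0}" t f] assms(4) by auto
  moreover have "sum f I = f i0 + sum f (I - {i0})" using assms(1,2) by (rule sum.remove)
  moreover have "card I = Suc (card (I - {i0}))" using assms(1,2) by (rule card.remove)
  ultimately show ?thesis using assms(3) by simp
qed

lemma row_in_cover_rectangles:
  "i \<in> {1..m} \<Longrightarrow> {i} \<times> {1..n} \<in> cover_rectangles m n"
  unfolding cover_rectangles_def by (intro CollectI exI[of _ "{i}"] exI[of _ "{1..n}"]) simp

lemma column_in_cover_rectangles: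
  "j \<in> {1..n} \<Longrightarrow> {1..n} \<times> {j} \<in> cover_rectangles n n"
  unfolding cover_rectangles_def by (intro CollectI exI[of _ "{1..n}"] exI[of _ "{j}"]) auto

abbreviation isolated_on_board :: "nat \<Rightarrow> nat \<Rightarrow> nat \<Rightarrow> (nat \<times> nat) set \<Rightarrow> ((nat \<times> nat) \<Rightarrow>\<^sub>0 nat) \<Rightarrow> bool"
  where "isolated_on_board m n \<equiv> isolated (squares m n) (cover_rectangles m n)"

text \<open>The rows partition the board, and at most one of them falls below weight \<open>t\<close>.\<close>

lemma isolated_degree_ge:
  assumes e: "isolated_on_board m n t C e" and n: "1 \<le> n"
  shows "m * t - 1 \<le> mon_degree e"
    and "C \<notin> (\<lambda>i. {i} \<times> {1..n}) ` {1..m} \<Longrightarrow> m * t \<le> mon_degree e"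
proof -
  have deg: "mon_degree e = (\<Sum>i\<in>{1..m}. weight ({i} \<times> {1..n}) e)"
    using e mon_degree_eq_weight[of e m n] weight_rows[of "{1..m}" "{1..n}" e]
    by (simp add: isolated_def squares_def)
  have big: "t \<le> weight ({i} \<times> {1..n}) e" if "i \<in> {1..m}" "{i} \<times> {1..n} \<noteq> C" for i
    using e that(2) row_in_cover_rectangles[OF that(1), of n] by (simp add: isolated_def)
  show *: "m * t \<le> mon_degree e" if C: "C \<notin> (\<lambda>i. {i} \<times> {1..n}) ` {1..m}"
  proof -
    have "t \<le> weight ({i} \<times> {1..n}) e" if i: "i \<in> {1..m}" for i
    proof (rule big[OF i])
      show "{i} \<times> {1..n} \<noteq> C" using C i by blast
    qed
    then show ?thesis
      unfolding deg using sum_bounded_below[of "{1..m}" t] by simp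
  qed
  show "m * t - 1 \<le> mon_degree e"
  proof (cases "C \<in> (\<lambda>i. {i} \<times> {1..n}) ` {1..m}")
    case True
    then obtain i0 where i0: "i0 \<in> {1..m}" "C = {i0} \<times> {1..n}" by blast
    have "card {1..m} * t - 1 \<le> mon_degree e"
      unfolding deg
    proof (rule sum_ge_card_mult[OF _ i0(1)])
      show "Suc (weight ({i0} \<times> {1..n}) e) = t" using e i0 by (simp add: isolated_def)
      show "t \<le> weight ({i} \<times> {1..n}) e" if "i \<in> {1..m}" "i \<noteq> i0" for i
      proof (rule big[OF that(1)])
        show "{i} \<times> {1..n} \<noteq> C" unfolding i0(2) using that(2) n by (simp add: times_eq_iff)
      qed
    qed simp
    then show ?thesis by simp
  next
    case False
    from *[OF this] show ?thesis by simp
  qed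
qed

text \<open>On a square board the columns are minimal covers as well. An exceptional row is not a column when
\<open>n \<ge> 2\<close>, so one of the two partitions of the board has all parts of weight at least \<open>t\<close>.\<close>

lemma isolated_degree_ge_square:
  assumes e: "isolated_on_board n n t C e" and n: "2 \<le> n"
  shows "n * t \<le> mon_degree e"
proof (cases "C \<in> (\<lambda>i. {i} \<times> {1..n}) ` {1..n}")
  case True
  then obtain i where i: "C = {i} \<times> {1..n}" by blast
  have "t \<le> weight ({1..n} \<times> {j}) e" if j: "j \<in> {1..n}" for j
  proof -
    have "{1..n} \<times> {j} \<noteq> C"
    proof
      assume "{1..n} \<times> {j} = C"
      then have "{1..n} = {i}" unfolding i using n by (simp add: times_eq_iff)
      then have "card {1..n} = card {i}" by (rule arg_cong)
      then show False using n by simp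
    qed
    then show ?thesis
      using e column_in_cover_rectangles[OF j] by (simp add: isolated_def)
  qed
  then have "card {1..n} * t \<le> (\<Sum>j\<in>{1..n}. weight ({1..n} \<times> {j}) e)"
    using sum_bounded_below[of "{1..n}" t] by simp
  also have "\<dots> = mon_degree e"
    using e mon_degree_eq_weight[of e n n] weight_columns[of "{1..n}" "{1..n}" e]
    by (simp add: isolated_def squares_def)
  finally show ?thesis by simp
next
  case False
  then show ?thesis using isolated_degree_ge(2)[OF e] n by simp
qed

definition board_exponent :: "nat \<Rightarrow> nat \<Rightarrow> (nat \<Rightarrow> nat \<Rightarrow> nat) \<Rightarrow> ((nat \<times> nat) \<Rightarrow>\<^sub>0 nat)" where
  "board_exponent m n f = Abs_poly_mapping (\<lambda>(i, j). if (i, j) \<in> squares m n then f i j else 0)"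

lemma lookup_board_exponent:
  "Poly_Mapping.lookup (board_exponent m n f) (i, j) = (if (i, j) \<in> squares m n then f i j else 0)"
proof -
  have "finite {v. (case v of (i, j) \<Rightarrow> if (i, j) \<in> squares m n then f i j else 0) \<noteq> 0}"
    by (rule finite_subset[OF _ finite_squares[of m n]]) (auto split: if_splits)
  then show ?thesis unfolding board_exponent_def by simp
qed

lemma keys_board_exponent: "Poly_Mapping.keys (board_exponent m n f) \<subseteq> squares m n"
  by (auto simp: in_keys_iff lookup_board_exponent split: if_splits)

lemma weight_board_exponent:
  assumes "R \<subseteq> {1..m}" "D \<subseteq> {1..n}"
  shows "weight (R \<times> D) (board_exponent m n f) = (\<Sum>i\<in>R. \<Sum>j\<in>D. f i j)"
  unfolding weight_times
proof (intro sum.cong refl)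
  fix i j assume "i \<in> R" "j \<in> D"
  then have "(i, j) \<in> squares m n" using assms by (auto simp: squares_def)
  then show "Poly_Mapping.lookup (board_exponent m n f) (i, j) = f i j"
    by (simp add: lookup_board_exponent)
qed

text \<open>The weight of a rectangle for \<open>a\<close> copies of the diagonal placement together with one copy of the
placement \<open>\<sigma>\<close>.\<close>

lemma sum_two_placements:
  fixes a :: nat
  assumes "finite R" "finite D"
  shows "(\<Sum>i\<in>R. \<Sum>j\<in>D. (if j = i then a else 0) + (if j = \<sigma> i then 1 else 0)) =
    a * card (R \<inter> D) + card {i \<in> R. \<sigma> i \<in> D}"
proof -
  have "(\<Sum>i\<in>R. \<Sum>j\<in>D. (if j = i then a else 0) + (if j = \<sigma> i then 1 else 0)) =
      (\<Sum>i\<in>R. (if i \<in> D then a else 0) + (if \<sigma> i \<in> D then 1 else 0))"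
    using assms(2) by (simp add: sum.distrib)
  also have "\<dots> = a * card (R \<inter> D) + card {i \<in> R. \<sigma> i \<in> D}"
    using assms(1) by (simp add: sum.distrib sum.If_cases Int_def mult.commute)
  finally show ?thesis .
qed

lemma sum_single_square:
  fixes a :: nat
  assumes "finite R" "finite D"
  shows "(\<Sum>i\<in>R. \<Sum>j\<in>D. if i = p \<and> j = q then a else 0) = (if p \<in> R \<and> q \<in> D then a else 0)"
proof -
  have "(\<Sum>j\<in>D. if i = p \<and> j = q then a else 0) = (if i = p then (if q \<in> D then a else 0) else 0)" for i
    using assms(2) by auto
  then show ?thesis using assms(1) by simp
qed

text \<open>Inclusion and exclusion: the intersection is a single point only if the two sets exhaust all
columns.\<close>

lemma overlap:
  assumes "A \<subseteq> {1..n}" "D \<subseteq> {1..n}" "card A + card D = n + 1"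
  shows "1 \<le> card (A \<inter> D)" and "card (A \<inter> D) = 1 \<Longrightarrow> A \<union> D = {1..n}"
proof -
  have fin: "finite A" "finite D" using assms(1,2) by (auto intro: finite_subset)
  have eq: "card A + card D = card (A \<union> D) + card (A \<inter> D)" by (rule card_Un_Int[OF fin])
  have "card (A \<union> D) \<le> card {1..n}" using assms(1,2) by (intro card_mono) auto
  then show "1 \<le> card (A \<inter> D)" using eq assms(3) by simp
  show "A \<union> D = {1..n}" if "card (A \<inter> D) = 1"
    using eq assms that by (intro card_subset_eq) auto
qed

text \<open>A rectangle meets the placement \<open>\<sigma>\<close> for the same reason as it meets the diagonal one.\<close>

lemma overlap_image:
  assumes "inj_on \<sigma> {1..m}" "\<sigma> ` {1..m} \<subseteq> {1..n}"
    and "R \<subseteq> {1..m}" "D \<subseteq> {1..n}" "card R + card D = n + 1"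
  shows "1 \<le> card {i \<in> R. \<sigma> i \<in> D}"
    and "card {i \<in> R. \<sigma> i \<in> D} = 1 \<Longrightarrow> \<sigma> ` R \<union> D = {1..n}"
proof -
  have inj: "inj_on \<sigma> R" using assms(1,3) by (rule inj_on_subset)
  have "\<sigma> ` {i \<in> R. \<sigma> i \<in> D} = \<sigma> ` R \<inter> D" by blast
  moreover have "card (\<sigma> ` {i \<in> R. \<sigma> i \<in> D}) = card {i \<in> R. \<sigma> i \<in> D}"
    by (rule card_image) (rule inj_on_subset[OF inj], blast)
  ultimately have c: "card {i \<in> R. \<sigma> i \<in> D} = card (\<sigma> ` R \<inter> D)" by simp
  have "\<sigma> ` R \<subseteq> {1..n}" using assms(2,3) by blast
  moreover have "card (\<sigma> ` R) = card R" by (rule card_image[OF inj])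
  ultimately show "1 \<le> card {i \<in> R. \<sigma> i \<in> D}"
    and "card {i \<in> R. \<sigma> i \<in> D} = 1 \<Longrightarrow> \<sigma> ` R \<union> D = {1..n}"
    using overlap[of "\<sigma> ` R" n D] assms(4,5) unfolding c by simp_all
qed

text \<open>Here \<open>x\<close> and \<open>y\<close> count the rooks of the two placements inside a rectangle. If it contains more than
one rook of either, it can afford to lose a rook; this needs \<open>t \<ge> 2\<close>.\<close>

lemma two_placements_ge:
  fixes t x y :: nat
  assumes "2 \<le> t" "1 \<le> x" "1 \<le> y"
  shows "t \<le> (t - 1) * x + y" and "x \<noteq> 1 \<or> y \<noteq> 1 \<Longrightarrow> Suc t \<le> (t - 1) * x + y"
proof -
  have "(t - 1) * 1 \<le> (t - 1) * x" using assms(2) by (rule mult_le_mono2)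
  then show "t \<le> (t - 1) * x + y" using assms(3) by linarith
  show "Suc t \<le> (t - 1) * x + y" if ne: "x \<noteq> 1 \<or> y \<noteq> 1"
  proof (cases "x = 1")
    case True
    then show ?thesis using ne assms by simp
  next
    case False
    then have "(t - 1) * 2 \<le> (t - 1) * x" using assms(2) by (intro mult_le_mono2) simp
    then show ?thesis using assms(1,3) by linarith
  qed
qed

lemma card_one_eq:
  assumes "card A = 1" "x \<in> A" "y \<in> A"
  shows "x = y"
proof -
  obtain a where "A = {a}" using assms(1) by (rule card_1_singletonE)
  then show ?thesis using assms(2,3) by simp
qed

text \<open>A rectangle that contains only one rook of each placement, both in the first row, is the first row.
Otherwise let \<open>i > 1\<close> be the last row of \<open>R\<close>. Its rook of the second placement is not in the
rectangle, so the column \<open>\<sigma> i\<close> is not in \<open>D\<close>. As \<open>R\<close> and \<open>D\<close> together exhaust all numbers up to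
\<open>n\<close>, the number \<open>\<sigma> i\<close> is in \<open>R\<close>. But it is greater than \<open>i\<close> or equal to \<open>1\<close>, which lies in \<open>D\<close>.\<close>

lemma first_row_only:
  assumes \<sigma>: "inj_on \<sigma> {1..m}" "\<sigma> ` {1..m} \<subseteq> {1..n}"
    and up: "\<And>i. i \<in> {1..m} \<Longrightarrow> i < \<sigma> i \<or> \<sigma> i = 1"
    and m: "m \<le> n"
    and R: "R \<subseteq> {1..m}" and D: "D \<subseteq> {1..n}" and card: "card R + card D = n + 1"
    and "1 \<in> R" "1 \<in> D" "\<sigma> 1 \<in> D"
    and one: "card (R \<inter> D) = 1" "card {i \<in> R. \<sigma> i \<in> D} = 1"
  shows "R \<times> D = {1} \<times> {1..n}"
proof -
  have fin: "finite R" "finite D" using R D by (auto intro: finite_subset)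
  have "R \<subseteq> {1..n}" using R m by auto
  then have cover: "R \<union> D = {1..n}" by (rule overlap(2)[OF _ D card one(1)])
  have "Max R \<in> R" using fin(1) assms(8) by (intro Max_in) auto
  have "Max R = 1"
  proof (rule ccontr)
    assume ne: "Max R \<noteq> 1"
    have "\<sigma> (Max R) \<notin> D"
    proof
      assume "\<sigma> (Max R) \<in> D"
      then show False
        using card_one_eq[OF one(2), of "Max R" 1] \<open>Max R \<in> R\<close> assms(8,10) ne by simp
    qed
    moreover have "\<sigma> (Max R) \<in> {1..n}" using \<sigma>(2) R \<open>Max R \<in> R\<close> by blast
    ultimately have "\<sigma> (Max R) \<in> R" "\<sigma> (Max R) \<noteq> 1" using cover assms(9) by auto
    then show False
      using up[of "Max R"] R \<open>Max R \<in> R\<close> Max_ge[OF fin(1), of "\<sigma> (Max R)"] by auto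
  qed
  then have "R \<subseteq> {1}" using R Max_ge[OF fin(1)] by fastforce
  then have R1: "R = {1}" using assms(8) by blast
  then have "card D = card {1..n}" using card by simp
  then have "D = {1..n}" using D by (intro card_subset_eq) auto
  then show ?thesis using R1 by simp
qed

text \<open>The second placement is the superdiagonal \<open>(i, i + 1)\<close>, and its rook at \<open>(1, 2)\<close> is removed. The
superdiagonal leaves the first column empty; a rectangle with one superdiagonal rook therefore
contains that column, as \<open>first_row_only\<close> requires.\<close>

lemma isolated_wide:
  assumes m: "2 \<le> m" "m < n" and t: "2 \<le> t"
  defines "e \<equiv> board_exponent m n
    (\<lambda>i j. (if j = i then t - 1 else 0) + (if j = Suc i \<and> i \<noteq> 1 then 1 else 0))"
  shows "isolated_on_board m n t ({1} \<times> {1..n}) e" and "mon_degree e = m * t - 1"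
proof -
  have w: "weight (R \<times> D) e + (if 1 \<in> R \<and> 2 \<in> D then 1 else 0) =
      (t - 1) * card (R \<inter> D) + card {i \<in> R. Suc i \<in> D}"
    if RD: "R \<subseteq> {1..m}" "D \<subseteq> {1..n}" for R D
  proof -
    have fin: "finite R" "finite D" using RD by (auto intro: finite_subset)
    have "weight (R \<times> D) e + (if 1 \<in> R \<and> 2 \<in> D then 1 else 0) =
        (\<Sum>i\<in>R. \<Sum>j\<in>D. ((if j = i then t - 1 else 0) + (if j = Suc i \<and> i \<noteq> 1 then 1 else 0)) +
          (if i = 1 \<and> j = 2 then 1 else 0))"
      unfolding e_def weight_board_exponent[OF RD] sum_single_square[OF fin, symmetric] sum.distrib ..
    also have "\<dots> = (\<Sum>i\<in>R. \<Sum>j\<in>D. (if j = i then t - 1 else 0) + (if j = Suc i then 1 else 0))"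
      by (intro sum.cong refl) auto
    finally show ?thesis by (simp only: sum_two_placements[OF fin])
  qed
  have \<sigma>: "inj_on Suc {1..m}" "Suc ` {1..m} \<subseteq> {1..n}" using m by auto
  have "t \<le> weight C e" if C: "C \<in> cover_rectangles m n" "C \<noteq> {1} \<times> {1..n}" for C
  proof -
    obtain R D where C_eq: "C = R \<times> D" and RD: "R \<subseteq> {1..m}" "D \<subseteq> {1..n}" "card R + card D = n + 1"
      using C(1) unfolding cover_rectangles_def by blast
    define x y where "x = card (R \<inter> D)" and "y = card {i \<in> R. Suc i \<in> D}"
    have "R \<subseteq> {1..n}" using RD(1) m by auto
    then have x: "1 \<le> x" unfolding x_def using overlap(1) RD by blast
    have y: "1 \<le> y" unfolding y_def using overlap_image(1)[OF \<sigma> RD] .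
    note w' = w[OF RD(1,2), folded x_def y_def]
    show ?thesis
    proof (cases "1 \<in> R \<and> 2 \<in> D \<and> x = 1 \<and> y = 1")
      case True
      \<comment> \<open>The only case where a rectangle could drop to weight \<open>t - 1\<close>.\<close>
      have "Suc ` R \<union> D = {1..n}" using overlap_image(2)[OF \<sigma> RD] True by (simp add: y_def)
      moreover have "1 \<notin> Suc ` R" "1 \<in> {1..n}" using RD(1) m by auto
      ultimately have "1 \<in> D" by blast
      then have "R \<times> D = {1} \<times> {1..n}"
        using True RD m by (intro first_row_only[OF \<sigma>]) (auto simp: x_def y_def numeral_2_eq_2)
      then show ?thesis using C(2) C_eq by simp
    next
      case False
      then show ?thesis
        using w' two_placements_ge[OF t x y] unfolding C_eq by (auto split: if_splits)
    qed
  qed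
  moreover have "Suc (weight ({1} \<times> {1..n}) e) = t"
  proof -
    have "{1} \<inter> {1..n} = {1}" "{i \<in> {1}. Suc i \<in> {1..n}} = {1}" using m by auto
    then show ?thesis using w[of "{1}" "{1..n}"] m t by simp
  qed
  ultimately show "isolated_on_board m n t ({1} \<times> {1..n}) e"
    unfolding isolated_def
    using m keys_board_exponent row_in_cover_rectangles[of 1 m n] by (simp add: e_def)
  have "mon_degree e = weight ({1..m} \<times> {1..n}) e"
    using mon_degree_eq_weight[OF keys_board_exponent[of m n]] unfolding e_def squares_def .
  moreover have "{1..m} \<inter> {1..n} = {1..m}" "{i \<in> {1..m}. Suc i \<in> {1..n}} = {1..m}" using m by auto
  ultimately have "mon_degree e + 1 = (t - 1) * m + m"
    using w[of "{1..m}" "{1..n}"] m by simp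
  then show "mon_degree e = m * t - 1"
    using t by (cases t) (simp_all add: algebra_simps)
qed

text \<open>The second placement is cyclic, as there is no column \<open>n + 1\<close>. The rook at \<open>(1, 1)\<close> is moved down
to \<open>(2, 1)\<close>, which keeps all column weights. Only rectangles that contain \<open>(1, 1)\<close> but not row \<open>2\<close>
can lose weight. Removing a rook of the diagonal is what works here: in the critical case \<open>R\<close> and \<open>D\<close> exhaust
all numbers up to \<open>n\<close>, so \<open>2 = \<sigma> 1\<close> is in \<open>D\<close> when it is not in \<open>R\<close>, and the single cyclic
rook is the one in the first row.\<close>

lemma isolated_square:
  assumes n: "2 \<le> n" and t: "2 \<le> t"
  defines "\<sigma> \<equiv> \<lambda>i. if i < n then Suc i else 1"
  defines "e \<equiv> board_exponent n n
    (\<lambda>i j. (if j = i then (if i = 1 then t - 2 else t - 1) else 0) + (if j = \<sigma> i then 1 else 0) +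
      (if i = 2 \<and> j = 1 then 1 else 0))"
  shows "isolated_on_board n n t ({1} \<times> {1..n}) e" and "mon_degree e = n * t"
proof -
  have w: "weight (R \<times> D) e + (if 1 \<in> R \<and> 1 \<in> D then 1 else 0) =
      (t - 1) * card (R \<inter> D) + card {i \<in> R. \<sigma> i \<in> D} + (if 2 \<in> R \<and> 1 \<in> D then 1 else 0)"
    if RD: "R \<subseteq> {1..n}" "D \<subseteq> {1..n}" for R D
  proof -
    have fin: "finite R" "finite D" using RD by (auto intro: finite_subset)
    have "weight (R \<times> D) e + (if 1 \<in> R \<and> 1 \<in> D then 1 else 0) =
        (\<Sum>i\<in>R. \<Sum>j\<in>D. ((if j = i then (if i = 1 then t - 2 else t - 1) else 0) +
          (if j = \<sigma> i then 1 else 0) + (if i = 2 \<and> j = 1 then 1 else 0)) +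
          (if i = 1 \<and> j = 1 then 1 else 0))"
      unfolding e_def weight_board_exponent[OF RD] sum_single_square[OF fin, symmetric] sum.distrib ..
    also have "\<dots> = (\<Sum>i\<in>R. \<Sum>j\<in>D. ((if j = i then t - 1 else 0) + (if j = \<sigma> i then 1 else 0)) +
        (if i = 2 \<and> j = 1 then 1 else 0))"
      using t by (intro sum.cong refl) auto
    also have "\<dots> = (\<Sum>i\<in>R. \<Sum>j\<in>D. (if j = i then t - 1 else 0) + (if j = \<sigma> i then 1 else 0)) +
        (if 2 \<in> R \<and> 1 \<in> D then 1 else 0)"
      unfolding sum_single_square[OF fin, symmetric] sum.distrib ..
    finally show ?thesis by (simp only: sum_two_placements[OF fin])
  qed
  have \<sigma>: "inj_on \<sigma> {1..n}" "\<sigma> ` {1..n} \<subseteq> {1..n}"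
    using n by (auto simp: \<sigma>_def inj_on_def split: if_splits)
  have "t \<le> weight C e" if C: "C \<in> cover_rectangles n n" "C \<noteq> {1} \<times> {1..n}" for C
  proof -
    obtain R D where C_eq: "C = R \<times> D" and RD: "R \<subseteq> {1..n}" "D \<subseteq> {1..n}" "card R + card D = n + 1"
      using C(1) unfolding cover_rectangles_def by blast
    define x y where "x = card (R \<inter> D)" and "y = card {i \<in> R. \<sigma> i \<in> D}"
    have x: "1 \<le> x" unfolding x_def using overlap(1) RD by blast
    have y: "1 \<le> y" unfolding y_def using overlap_image(1)[OF \<sigma> RD] .
    note w' = w[OF RD(1,2), folded x_def y_def]
    show ?thesis
    proof (cases "1 \<in> R \<and> 1 \<in> D \<and> 2 \<notin> R \<and> x = 1 \<and> y = 1")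
      case True
      have "R \<union> D = {1..n}" using overlap(2)[OF RD] True by (simp add: x_def)
      then have "\<sigma> 1 \<in> D" using True n by (auto simp: \<sigma>_def numeral_2_eq_2)
      then have "R \<times> D = {1} \<times> {1..n}"
        using True RD n by (intro first_row_only[OF \<sigma>]) (auto simp: x_def y_def \<sigma>_def)
      then show ?thesis using C(2) C_eq by simp
    next
      case False
      then show ?thesis
        using w' two_placements_ge[OF t x y] unfolding C_eq by (auto split: if_splits)
    qed
  qed
  moreover have "Suc (weight ({1} \<times> {1..n}) e) = t"
  proof -
    have "{1} \<inter> {1..n} = {1}" "{i \<in> {1}. \<sigma> i \<in> {1..n}} = {1}" using n by (auto simp: \<sigma>_def)
    then show ?thesis using w[of "{1}" "{1..n}"] n t by simp
  qed
  ultimately show "isolated_on_board n n t ({1} \<times> {1..n}) e"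
    unfolding isolated_def
    using n keys_board_exponent row_in_cover_rectangles[of 1 n n] by (simp add: e_def)
  have "mon_degree e = weight ({1..n} \<times> {1..n}) e"
    using mon_degree_eq_weight[OF keys_board_exponent[of n n]] unfolding e_def squares_def .
  moreover have "{i \<in> {1..n}. \<sigma> i \<in> {1..n}} = {1..n}" using \<sigma>(2) by auto
  ultimately have "mon_degree e + 1 = (t - 1) * n + n + 1"
    using w[of "{1..n}" "{1..n}"] n by simp
  then show "mon_degree e = n * t"
    using t by (cases t) (simp_all add: algebra_simps)
qed

lemma cover_rectangles_one_row: "cover_rectangles 1 n = {{1} \<times> {1..n}}"
proof (intro equalityI subsetI)
  fix C assume "C \<in> cover_rectangles 1 n"
  then obtain R D where RD: "C = R \<times> D" "R \<subseteq> {1..1}" "D \<subseteq> {1..n}" "R \<noteq> {}" "card R + card D = n + 1"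
    unfolding cover_rectangles_def by blast
  then have "R = {1}" by auto
  moreover from this have "D = {1..n}" using RD(3,5) by (intro card_subset_eq) auto
  ultimately show "C \<in> {{1} \<times> {1..n}}" using RD(1) by simp
qed (use row_in_cover_rectangles[of 1 1 n] in simp)

lemma isolated_one_row:
  assumes "1 \<le> n" "2 \<le> t"
  shows "isolated_on_board 1 n t ({1} \<times> {1..n}) (Poly_Mapping.single (1, 1) (t - 1))"
  unfolding isolated_def cover_rectangles_one_row
  using assms by (simp add: weight_single squares_def)

lemma isolated_one_row_degree:
  assumes "isolated_on_board 1 n t C e"
  shows "mon_degree e = t - 1"
proof -
  have "C = squares 1 n" "Poly_Mapping.keys e \<subseteq> squares 1 n" "Suc (weight C e) = t"
    using assms unfolding isolated_def cover_rectangles_one_row squares_def by auto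
  then show ?thesis using mon_degree_eq_weight[of e 1 n] by simp
qed

lemma v_number_facet_ideal_symbolic_power:
  assumes "m \<le> n" "1 \<le> t" and e0: "isolated_on_board m n t C0 e0"
    and least: "\<And>C e. isolated_on_board m n t C e \<Longrightarrow> mon_degree e0 \<le> mon_degree e"
  shows "v_number m n
    (symbolic_power (board_poly m n) (facet_ideal m n :: 'k::field grid_poly set) t) = mon_degree e0"
proof -
  let ?E = "facets (chessboard_complex m n)"
  have E: "?E \<subseteq> Pow (squares m n)" by (auto simp: facets_def chessboard_complex_def)
  have "(\<lambda>i. (i, i)) ` {1..m} \<in> ?E"
    using assms(1) by (intro rook_placement_facet) auto
  then have ne: "?E \<noteq> {}" by blast
  have iso: "isolated (squares m n) (min_covers (squares m n) ?E) t C e \<longleftrightarrow> isolated_on_board m n t C e" for C e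
    unfolding min_covers_chessboard[OF assms(1)] ..
  show ?thesis
    unfolding facet_ideal_eq_edge_ideal symbolic_power_edge_ideal[OF E]
    using e0 least by (intro v_number_J[OF E ne assms(2)]) (simp_all add: iso)
qed

theorem theorem1p5:
  fixes m n t :: nat
  assumes "1 \<le> m" and "m \<le> n" and "2 \<le> t"
  shows "v_number m n
           (symbolic_power (board_poly m n) (facet_ideal m n :: 'k::field grid_poly set) t) =
         (if m = 1 then t - 1 else if n = m then m * t else m * t - 1)"
proof -
  note v = v_number_facet_ideal_symbolic_power[OF assms(2), of t, where 'k = 'k]
  have t: "1 \<le> t" using assms(3) by simp
  consider "m = 1" | "2 \<le> m" "n = m" | "2 \<le> m" "m < n" using assms by linarith
  then show ?thesis
  proof cases
    case 1
    have e0: "isolated_on_board m n t ({1} \<times> {1..n}) (Poly_Mapping.single (1, 1) (t - 1))"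
      using isolated_one_row[of n t] assms unfolding 1 by simp
    have deg: "mon_degree e = t - 1" if "isolated_on_board m n t C e" for C e
      using isolated_one_row_degree that unfolding 1 .
    have "mon_degree (Poly_Mapping.single (1, 1) (t - 1)) \<le> mon_degree e"
      if "isolated_on_board m n t C e" for C e using deg[OF e0] deg[OF that] by simp
    from v[OF t e0 this] show ?thesis using deg[OF e0] 1 by simp
  next
    case 2
    note e0 = isolated_square[OF 2(1) assms(3)]
    show ?thesis
      using v[OF t, unfolded 2(2), OF e0(1), unfolded e0(2), OF isolated_degree_ge_square] 2
      by simp
  next
    case 3
    note e0 = isolated_wide[OF 3 assms(3)]
    show ?thesis
      using v[OF t e0(1), unfolded e0(2), OF isolated_degree_ge(1)] 3
      by simp
  qed
qed

end
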